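(* The map $x\in D_0([0,1],\mathbb R_+)\mapsto(\mathscr T_x,\mu_x)$ is continuous when $D_0([0,1],\mathbb R_+)$ is endowed with the distance $d_{M_1}$ and the set of isometry classes of measured rooted compact metric spaces is endowed with the distance $d_{\mathrm{GHP}}$.
   Context: $D([0,1])$ is the set of càdlàg (right-continuous with left limits) functions $[0,1]\to\mathbb R$, with the convention $x(0-)=x(0)$. $C_0([0,1],\mathbb R_+)$ (resp. $D_0([0,1],\mathbb R_+)$) is the set of continuous (resp. càdlàg) functions $[0,1]\to\mathbb R_+=[0,\infty)$ vanishing at $0$ and $1$. For $f\in C_0([0,1],\mathbb R_+)$ let $d_f(s,t)=f(s)+f(t)-2\inf_{[s\wedge t,s\vee t]}f$, a pseudo-distance on $[0,1]$; $\mathscr T_f$ is the quotient of $[0,1]$ by the relation $d_f(s,t)=0$, with the distance induced by $d_f$, rooted at $\pi_f(0)$, where $\pi_f:[0,1]\to\mathscr T_f$ is the canonical projection. It is a rooted compact metric space. For $x\in D([0,1])$ the completed graph is $\Gamma_x=\{(\lambda x(t-)+(1-\lambda)x(t),t):(t,\lambda)\in[0,1]^2\}\subset\mathbb R\times[0,1]$, ordered by: $(z_1,t_1)\le(z_2,t_2)$ if either $t_1<t_2$, or $t_1=t_2$ and $|z_1-x(t_1-)|\le|z_2-x(t_2-)|$. A parametric representation of $x$ is a non-decreasing (for this order), continuous and onto function $(\chi,\tau):[0,1]\to\Gamma_x$, with spatial component $\chi:[0,1]\to\mathbb R$ and temporal component $\tau:[0,1]\to[0,1]$; $\mathscr P(x)$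 is the set of all of them. The $M_1$ distance is $d_{M_1}(x_1,x_2)=\inf\{\|\chi_1-\chi_2\|_\infty\vee\|\tau_1-\tau_2\|_\infty:(\chi_i,\tau_i)\in\mathscr P(x_i),\ i=1,2\}$. For $x\in D_0([0,1],\mathbb R_+)$, $(\mathscr T_x,\mu_x)$ is the isometry class (as a measured rooted metric space) of $(\mathscr T_\chi,\mu_{(\chi,\tau)})$ where $(\chi,\tau)\in\mathscr P(x)$ is arbitrary and $\mu_{(\chi,\tau)}$ is the law of $\pi_\chi(\tau^{-1}(U))$, with $U$ uniform on $[0,1]$ and $\tau^{-1}$ the right-continuous inverse of $\tau$; it does not depend on the choice of $(\chi,\tau)$. For rooted compact metric spaces with Borel probability measures $(K_i,d_i,x_i,\mu_i)$, $i=1,2$, the Gromov-Hausdorff-Prokhorov distance is $d_{\mathrm{GHP}}=\inf_{\mathcal C,\nu}\frac12\mathrm{dis}(\mathcal C)\vee(1-\nu(\mathcal C))$, the infimum being over correspondences $\mathcal C\subset K_1\times K_2$ (measurable subsets whose projections on $K_1$ and $K_2$ are onto) containing $(x_1,x_2)$ and couplings $\nu$ of $\mu_1$ and $\mu_2$, where $\mathrm{dis}(\mathcal C)=\sup\{|d_1(y_1,z_1)-d_2(y_2,z_2)|:(y_1,y_2),(z_1,z_2)\in\mathcal C\}$. *)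

theory Defs
  imports "HOL-Probability.Probability"
begin

text \<open>
  A function on the unit interval is represented by a total function \<^typ>\<open>real \<Rightarrow> real\<close>;
  every notion below depends only on its values on \<^term>\<open>{0..1::real}\<close>.
\<close>

section \<open>Cadlag functions and the M1 distance\<close>

definition cadlag :: "(real \<Rightarrow> real) \<Rightarrow> bool" where
  "cadlag x \<longleftrightarrow>
     (\<forall>t\<in>{0..<1}. continuous (at_right t) x) \<and>
     (\<forall>t\<in>{0<..1}. \<exists>l. (x \<longlongrightarrow> l) (at_left t))"

definition D0_nonneg :: "(real \<Rightarrow> real) set" where
  "D0_nonneg = {x. cadlag x \<and> (\<forall>t\<in>{0..1}. 0 \<le> x t) \<and> x 0 = 0 \<and> x 1 = 0}"

definition left_limit :: "(real \<Rightarrow> real) \<Rightarrow> real \<Rightarrow> real" where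
  "left_limit x t = (if t = 0 then x 0 else Lim (at_left t) x)"

definition completed_graph :: "(real \<Rightarrow> real) \<Rightarrow> (real \<times> real) set" where
  "completed_graph x =
     {(l * left_limit x t + (1 - l) * x t, t) | t l. t \<in> {0..1} \<and> l \<in> {0..1}}"

definition graph_le :: "(real \<Rightarrow> real) \<Rightarrow> real \<times> real \<Rightarrow> real \<times> real \<Rightarrow> bool" where
  "graph_le x = (\<lambda>(z1, t1) (z2, t2).
     t1 < t2 \<or> t1 = t2 \<and> \<bar>z1 - left_limit x t1\<bar> \<le> \<bar>z2 - left_limit x t2\<bar>)"

definition param_reps :: "(real \<Rightarrow> real) \<Rightarrow> ((real \<Rightarrow> real) \<times> (real \<Rightarrow> real)) set" where
  "param_reps x = {(chi, tau).
     continuous_on {0..1} (\<lambda>s. (chi s, tau s)) \<and>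
     (\<lambda>s. (chi s, tau s)) ` {0..1} = completed_graph x \<and>
     (\<forall>s\<in>{0..1}. \<forall>t\<in>{0..1}. s \<le> t \<longrightarrow> graph_le x (chi s, tau s) (chi t, tau t))}"

definition sup_dist :: "(real \<Rightarrow> real) \<Rightarrow> (real \<Rightarrow> real) \<Rightarrow> real" where
  "sup_dist f g = (SUP s\<in>{0..1}. \<bar>f s - g s\<bar>)"

definition d_M1 :: "(real \<Rightarrow> real) \<Rightarrow> (real \<Rightarrow> real) \<Rightarrow> real" where
  "d_M1 x1 x2 = Inf {max (sup_dist chi1 chi2) (sup_dist tau1 tau2) | chi1 tau1 chi2 tau2.
     (chi1, tau1) \<in> param_reps x1 \<and> (chi2, tau2) \<in> param_reps x2}"

section \<open>Measured rooted compact metric spaces\<close>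

record 'a mrspace =
  points :: "'a set"
  mdist :: "'a \<Rightarrow> 'a \<Rightarrow> real"
  mroot :: 'a
  mmeas :: "'a measure"

definition borel_metric :: "'a set \<Rightarrow> ('a \<Rightarrow> 'a \<Rightarrow> real) \<Rightarrow> 'a measure" where
  "borel_metric K d = sigma K {U. openin (Metric_space.mtopology K d) U}"

definition mrc_spaces :: "'a mrspace set" where
  "mrc_spaces = {K.
     Metric_space (points K) (mdist K) \<and>
     compact_space (Metric_space.mtopology (points K) (mdist K)) \<and>
     mroot K \<in> points K \<and>
     prob_space (mmeas K) \<and>
     space (mmeas K) = points K \<and>
     sets (mmeas K) = sets (borel_metric (points K) (mdist K))}"

definition mr_isometric :: "'a mrspace \<Rightarrow> 'b mrspace \<Rightarrow> bool" where
  "mr_isometric K L \<longleftrightarrow> (\<exists>f.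
     bij_betw f (points K) (points L) \<and>
     (\<forall>y\<in>points K. \<forall>z\<in>points K. mdist L (f y) (f z) = mdist K y z) \<and>
     f (mroot K) = mroot L \<and>
     distr (mmeas K) (mmeas L) f = mmeas L)"

definition mr_isometry_rel :: "('a mrspace \<times> 'a mrspace) set" where
  "mr_isometry_rel = {(K, L). K \<in> mrc_spaces \<and> L \<in> mrc_spaces \<and> mr_isometric K L}"

text \<open>
  The points of the trees below are equivalence classes of reals, so the spaces are taken over the
  type \<^typ>\<open>real set\<close>. This loses no isometry class: a compact metric space has at most
  continuum many points, hence is isometric to a metric space carried by a set of elements of
  \<^typ>\<open>real set\<close>.
\<close>

definition mrc_classes :: "real set mrspace set set" where
  "mrc_classes = mrc_spaces // mr_isometry_rel"

section \<open>The Gromov-Hausdorff-Prokhorov distance\<close>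

definition correspondences :: "'a mrspace \<Rightarrow> 'b mrspace \<Rightarrow> ('a \<times> 'b) set set" where
  "correspondences K L = {C \<in> sets (mmeas K \<Otimes>\<^sub>M mmeas L).
     C \<subseteq> points K \<times> points L \<and> fst ` C = points K \<and> snd ` C = points L}"

definition couplings :: "'a measure \<Rightarrow> 'b measure \<Rightarrow> ('a \<times> 'b) measure set" where
  "couplings M N = {\<nu>. sets \<nu> = sets (M \<Otimes>\<^sub>M N) \<and> distr \<nu> M fst = M \<and> distr \<nu> N snd = N}"

definition distortion :: "'a mrspace \<Rightarrow> 'b mrspace \<Rightarrow> ('a \<times> 'b) set \<Rightarrow> real" where
  "distortion K L C =
     Sup {\<bar>mdist K y1 z1 - mdist L y2 z2\<bar> | y1 y2 z1 z2. (y1, y2) \<in> C \<and> (z1, z2) \<in> C}"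

definition d_GHP :: "'a mrspace \<Rightarrow> 'b mrspace \<Rightarrow> real" where
  "d_GHP K L = Inf {max (distortion K L C / 2) (1 - measure \<nu> C) | C \<nu>.
     C \<in> correspondences K L \<and> (mroot K, mroot L) \<in> C \<and> \<nu> \<in> couplings (mmeas K) (mmeas L)}"

text \<open>\<^const>\<open>d_GHP\<close> is invariant under isometry, so the representatives do not matter.\<close>

definition d_GHP_class :: "'a mrspace set \<Rightarrow> 'b mrspace set \<Rightarrow> real" where
  "d_GHP_class \<K> \<L> = d_GHP (SOME K. K \<in> \<K>) (SOME L. L \<in> \<L>)"

section \<open>Trees coded by functions\<close>

definition tree_pdist :: "(real \<Rightarrow> real) \<Rightarrow> real \<Rightarrow> real \<Rightarrow> real" where
  "tree_pdist f s t = f s + f t - 2 * (INF r\<in>{min s t..max s t}. f r)"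

definition tree_rel :: "(real \<Rightarrow> real) \<Rightarrow> (real \<times> real) set" where
  "tree_rel f = {(s, t). s \<in> {0..1} \<and> t \<in> {0..1} \<and> tree_pdist f s t = 0}"

definition tree_points :: "(real \<Rightarrow> real) \<Rightarrow> real set set" where
  "tree_points f = {0..1} // tree_rel f"

definition tree_proj :: "(real \<Rightarrow> real) \<Rightarrow> real \<Rightarrow> real set" where
  "tree_proj f s = tree_rel f `` {s}"

text \<open>
  The value 0 off the carrier is there because \<^const>\<open>Metric_space\<close> requires nonnegativity and
  symmetry of the distance on the whole type.
\<close>

definition tree_dist :: "(real \<Rightarrow> real) \<Rightarrow> real set \<Rightarrow> real set \<Rightarrow> real" where
  "tree_dist f A B =
     (if A \<in> tree_points f \<and> B \<in> tree_points f
      then tree_pdist f (SOME s. s \<in> A) (SOME t. t \<in> B) else 0)"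

text \<open>The added element 1 only makes the value at \<open>u = 1\<close>, where the set is empty, equal to 1.\<close>

definition right_inverse :: "(real \<Rightarrow> real) \<Rightarrow> real \<Rightarrow> real" where
  "right_inverse tau u = Inf (insert 1 {s \<in> {0..1}. u < tau s})"

definition tree_measure :: "(real \<Rightarrow> real) \<Rightarrow> (real \<Rightarrow> real) \<Rightarrow> real set measure" where
  "tree_measure chi tau =
     distr (restrict_space lborel {0..1}) (borel_metric (tree_points chi) (tree_dist chi))
       (\<lambda>u. tree_proj chi (right_inverse tau u))"

definition coded_tree :: "(real \<Rightarrow> real) \<times> (real \<Rightarrow> real) \<Rightarrow> real set mrspace" where
  "coded_tree = (\<lambda>(chi, tau).
     \<lparr>points = tree_points chi, mdist = tree_dist chi, mroot = tree_proj chi 0,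
      mmeas = tree_measure chi tau\<rparr>)"

text \<open>
  The spaces isometric to the tree coded by some parametric representation of \<open>x\<close>. All parametric
  representations code isometric trees, so this is a single isometry class.
\<close>

definition tree_class :: "(real \<Rightarrow> real) \<Rightarrow> real set mrspace set" where
  "tree_class x = mr_isometry_rel `` (coded_tree ` param_reps x)"

end

theory Submission
  imports Defs
begin

text \<open>
  Let \<open>(chi1, tau1)\<close> and \<open>(chi2, tau2)\<close> represent \<open>x\<close> and \<open>y\<close> and be uniformly \<open>\<delta>\<close>-close. Pairing the
  points that \<open>chi1\<close> and \<open>chi2\<close> assign to the same \<open>s\<close> gives a correspondence of distortion at most
  \<open>4 * \<delta>\<close>, because the coding pseudo-distance depends on the function in a Lipschitz way. The masses are
  the difficulty: a uniform time \<open>u\<close> is sent to \<open>s1 = right_inverse tau1 u\<close> in one tree and to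
  \<open>s2 = right_inverse tau2 u\<close> in the other, and \<open>s1\<close> and \<open>s2\<close> may be far apart. Both belong, however, to a
  stretch of parameters that \<open>tau1\<close> maps into a \<open>\<delta>\<close>-neighbourhood of \<open>u\<close>, and over this stretch
  \<open>chi1\<close> runs through the completed graph of \<open>x\<close> near \<open>u\<close>. If \<open>x\<close> oscillates little near \<open>u\<close>, then
  \<open>s1\<close> and \<open>s2\<close> code points of the first tree that are close to each other
  (\<open>tree_pdist_right_inverses_le\<close>). So the correspondence is enlarged by all pairs \<open>(s, t)\<close> that are
  close for the first pseudo-distance, and the same \<open>u\<close> is used for both trees as a coupling; the
  coupling misses the enlarged correspondence only when \<open>x\<close> oscillates near \<open>u\<close>
  (\<open>d_GHP_codes_le\<close>). A cadlag function oscillates by more than a given amount only around finitely many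
  times (\<open>cadlag_finite_partition\<close>), hence these \<open>u\<close> have measure of order \<open>\<delta>\<close>. The bound uses the
  regularity of \<open>x\<close> alone, so it is the same for all \<open>y\<close> and for all choices of close
  representations.

  That \<open>tree_class x\<close> is one isometry class rests on two facts. A parametric representation exists: time
  is stretched at the jumps by adding a probability distribution with an atom at each of them
  (\<open>param_reps_nonempty\<close>). And any two representations of \<open>x\<close> run monotonically through the same ordered
  set, the completed graph; the pseudo-distance of two parameters is a function of the two points of the
  graph that they represent, so both representations code the same tree (\<open>codes_param_rep\<close>).
\<close>

section \<open>The pseudo-distance coded by a function\<close>

lemma tree_pdist_refl: "tree_pdist f s s = 0"
  by (simp add: tree_pdist_def)

lemma tree_pdist_commute: "tree_pdist f s t = tree_pdist f t s"
  by (simp add: tree_pdist_def min.commute max.commute)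

lemma bdd_below_unit_image:
  fixes f :: "real \<Rightarrow> real"
  assumes "continuous_on {0..1} f" "S \<subseteq> {0..1}"
  shows "bdd_below (f ` S)"
proof -
  have "compact (f ` {0..1})"
    using assms(1) by (rule compact_continuous_image) simp
  then have "bdd_below (f ` {0..1})"
    by (simp add: bounded_imp_bdd_below compact_imp_bounded)
  then show ?thesis
    using assms(2) by (meson bdd_below_mono image_mono)
qed

lemma tree_pdist_nonneg:
  assumes "continuous_on {0..1} f" "s \<in> {0..1}" "t \<in> {0..1}"
  shows "0 \<le> tree_pdist f s t"
proof -
  have "bdd_below (f ` {min s t..max s t})"
    using assms by (intro bdd_below_unit_image) auto
  then have "(INF r\<in>{min s t..max s t}. f r) \<le> f s" "(INF r\<in>{min s t..max s t}. f r) \<le> f t"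
    by (auto intro!: cINF_lower)
  then show ?thesis by (simp add: tree_pdist_def)
qed

text \<open>
  The interval from \<open>s\<close> to \<open>u\<close> is covered by those from \<open>s\<close> to \<open>t\<close> and from \<open>t\<close> to \<open>u\<close>. So its infimum is at least the
  smaller of their two infima, while the larger of the two is at most \<open>f t\<close>.
\<close>

lemma tree_pdist_triangle:
  assumes f: "continuous_on {0..1} f" and s: "s \<in> {0..1}" and t: "t \<in> {0..1}" and u: "u \<in> {0..1}"
  shows "tree_pdist f s u \<le> tree_pdist f s t + tree_pdist f t u"
proof -
  define m where "m a b = (INF r\<in>{min a b..max a b}. f r)" for a b
  have bdd: "bdd_below (f ` {min a b..max a b})" if "a \<in> {0..1}" "b \<in> {0..1}" for a b
    using that f by (intro bdd_below_unit_image) auto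
  have le: "m a b \<le> f r" if "a \<in> {0..1}" "b \<in> {0..1}" "r \<in> {min a b..max a b}" for a b r
    unfolding m_def using that bdd by (intro cINF_lower)
  have "min (m s t) (m t u) \<le> m s u"
    unfolding m_def[of s u]
  proof (rule cINF_greatest)
    fix r assume r: "r \<in> {min s u..max s u}"
    then have "r \<in> {min s t..max s t} \<or> r \<in> {min t u..max t u}" by auto
    then show "min (m s t) (m t u) \<le> f r"
      using le[OF s t] le[OF t u] by (meson min.coboundedI1 min.coboundedI2)
  qed auto
  moreover have "m s t \<le> f t" "m t u \<le> f t"
    using le[OF s t, of t] le[OF t u, of t] by auto
  ultimately show ?thesis
    unfolding tree_pdist_def m_def[symmetric] by linarith
qed

lemma tree_pdist_le_oscillation:
  assumes "\<And>r. r \<in> {min s t..max s t} \<Longrightarrow> \<bar>f r - c\<bar> \<le> e"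
  shows "tree_pdist f s t \<le> 4 * e"
proof -
  have "c - e \<le> (INF r\<in>{min s t..max s t}. f r)"
  proof (rule cINF_greatest)
    fix r assume "r \<in> {min s t..max s t}"
    then show "c - e \<le> f r" using assms[of r] by linarith
  qed auto
  moreover have "f s \<le> c + e" "f t \<le> c + e"
    using assms[of s] assms[of t] by auto
  ultimately show ?thesis by (simp add: tree_pdist_def)
qed

text \<open>
  Each of the two values and the infimum, which is counted twice, moves by at most \<open>d\<close>.
\<close>

lemma tree_pdist_perturb:
  assumes f: "continuous_on {0..1} f" and g: "continuous_on {0..1} g"
    and st: "s \<in> {0..1}" "t \<in> {0..1}"
    and d: "\<And>r. r \<in> {0..1} \<Longrightarrow> \<bar>f r - g r\<bar> \<le> d"
  shows "\<bar>tree_pdist f s t - tree_pdist g s t\<bar> \<le> 4 * d"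
proof -
  have one: "(INF r\<in>{min s t..max s t}. h r) - d \<le> (INF r\<in>{min s t..max s t}. k r)"
    if h: "continuous_on {0..1} h" and hk: "\<And>r. r \<in> {0..1} \<Longrightarrow> \<bar>h r - k r\<bar> \<le> d" for h k
  proof (rule cINF_greatest)
    fix r assume r: "r \<in> {min s t..max s t}"
    then have "(INF r\<in>{min s t..max s t}. h r) \<le> h r"
      using st by (intro cINF_lower bdd_below_unit_image[OF h]) auto
    moreover have "r \<in> {0..1}" using r st by auto
    ultimately show "(INF r\<in>{min s t..max s t}. h r) - d \<le> k r"
      using hk[of r] by linarith
  qed auto
  show ?thesis
    using one[OF f d] one[OF g, of f, unfolded abs_minus_commute[of "g _" "f _"], OF d]
      d[OF st(1)] d[OF st(2)]
    unfolding tree_pdist_def by linarith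
qed

lemma tree_pdist_uniformly_small:
  assumes f: "continuous_on {0..1} f" and e: "0 < e"
  obtains d where "0 < d"
    "\<And>s t. s \<in> {0..1} \<Longrightarrow> t \<in> {0..1} \<Longrightarrow> \<bar>s - t\<bar> < d \<Longrightarrow> tree_pdist f s t < e"
proof -
  have "uniformly_continuous_on {0..1} f"
    using f by (rule compact_uniformly_continuous) simp
  then obtain d where d: "0 < d"
    and D: "\<And>s t. s \<in> {0..1} \<Longrightarrow> t \<in> {0..1} \<Longrightarrow> dist t s < d \<Longrightarrow> dist (f t) (f s) < e / 5"
    unfolding uniformly_continuous_on_def using e by (metis divide_pos_pos zero_less_numeral)
  show thesis
  proof (rule that[OF d])
    fix s t :: real assume st: "s \<in> {0..1}" "t \<in> {0..1}" "\<bar>s - t\<bar> < d"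
    have "tree_pdist f s t \<le> 4 * (e / 5)"
    proof (rule tree_pdist_le_oscillation[where c = "f s"])
      fix r assume "r \<in> {min s t..max s t}"
      then have "r \<in> {0..1}" "dist r s < d" using st by (auto simp: dist_real_def)
      then show "\<bar>f r - f s\<bar> \<le> e / 5" using D[OF st(1)] by (force simp: dist_real_def)
    qed
    then show "tree_pdist f s t < e" using e by simp
  qed
qed

section \<open>Spaces coded by a pair of functions\<close>

text \<open>
  The map \<open>p\<close> exhibits \<open>K\<close>, up to isometry, as the tree coded by \<open>(chi, tau)\<close>, with \<open>p\<close> in the role of the
  canonical projection. All representatives of an isometry class are treated alike in this way, and no
  isometry has to be carried along.
\<close>

definition codes :: "(real \<Rightarrow> real) \<Rightarrow> (real \<Rightarrow> real) \<Rightarrow> (real \<Rightarrow> 'a) \<Rightarrow> 'a mrspace \<Rightarrow> bool" where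
  "codes chi tau p K \<longleftrightarrow>
     p ` {0..1} = points K \<and>
     (\<forall>s\<in>{0..1}. \<forall>t\<in>{0..1}. mdist K (p s) (p t) = tree_pdist chi s t) \<and>
     p 0 = mroot K \<and>
     distr (restrict_space lborel {0..1}) (mmeas K) (\<lambda>u. p (right_inverse tau u)) = mmeas K"

lemma right_inverse_unit: "right_inverse tau u \<in> {0..1}"
proof -
  have "bdd_below (insert 1 {s \<in> {0..1}. u < tau s})" by (rule bdd_belowI[of _ 0]) auto
  then have "right_inverse tau u \<le> 1" unfolding right_inverse_def by (intro cInf_lower) auto
  moreover have "0 \<le> right_inverse tau u"
    unfolding right_inverse_def by (rule cInf_greatest) auto
  ultimately show ?thesis by simp
qed

lemma mono_right_inverse: "mono (right_inverse tau)"
  unfolding mono_def right_inverse_def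
  by (intro allI impI cInf_superset_mono) (auto intro: bdd_belowI[of _ 0])

lemma space_unit_lborel [simp]: "space (restrict_space lborel {0..1::real}) = {0..1}"
  by (simp add: space_restrict_space)

lemma prob_space_unit_lborel: "prob_space (restrict_space lborel {0..1::real})"
  by (rule prob_spaceI) (simp add: emeasure_restrict_space)

lemma continuous_map_into_tree:
  assumes M: "Metric_space M d" and chi: "continuous_on {0..1} chi"
    and p: "\<And>s. s \<in> {0..1} \<Longrightarrow> p s \<in> M"
    and d: "\<And>s t. s \<in> {0..1} \<Longrightarrow> t \<in> {0..1} \<Longrightarrow> d (p s) (p t) = tree_pdist chi s t"
  shows "continuous_map (top_of_set {0..1}) (Metric_space.mtopology M d) p"
proof -
  interpret Metric_space M d by (rule M)
  show ?thesis
    unfolding continuous_map_to_metric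
  proof (intro ballI allI impI)
    fix s e :: real assume s: "s \<in> topspace (top_of_set {0..1})" and e: "0 < e"
    obtain r where r: "0 < r"
      "\<And>s t. s \<in> {0..1} \<Longrightarrow> t \<in> {0..1} \<Longrightarrow> \<bar>s - t\<bar> < r \<Longrightarrow> tree_pdist chi s t < e"
      using tree_pdist_uniformly_small[OF chi e] by blast
    have "openin (top_of_set {0..1}) ({0..1} \<inter> ball s r)"
      by (rule openin_open_Int) simp
    moreover have "\<forall>t\<in>{0..1} \<inter> ball s r. p t \<in> mball (p s) e"
      using s r p d by (auto simp: dist_real_def)
    moreover have "s \<in> {0..1} \<inter> ball s r" using s r by auto
    ultimately show "\<exists>U. openin (top_of_set {0..1}) U \<and> s \<in> U \<and> (\<forall>t\<in>U. p t \<in> mball (p s) e)"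
      by blast
  qed
qed

lemma sets_borel_metric:
  assumes "Metric_space M d"
  shows "sets (borel_metric M d) = sigma_sets M {U. openin (Metric_space.mtopology M d) U}"
    and "space (borel_metric M d) = M"
    and "{U. openin (Metric_space.mtopology M d) U} \<subseteq> Pow M"
proof -
  interpret Metric_space M d by (rule assms)
  show "{U. openin mtopology U} \<subseteq> Pow M"
    using openin_subset by fastforce
  then show "sets (borel_metric M d) = sigma_sets M {U. openin mtopology U}"
    "space (borel_metric M d) = M"
    by (simp_all add: borel_metric_def)
qed

lemma closedin_sets_borel_metric:
  assumes M: "Metric_space M d" and C: "closedin (Metric_space.mtopology M d) C"
  shows "C \<in> sets (borel_metric M d)"
proof -
  interpret Metric_space M d by (rule M)
  have "openin mtopology (M - C)" and "C \<subseteq> M"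
    using C by (auto simp: closedin_def)
  then have "M - (M - C) \<in> sigma_sets M {U. openin mtopology U}"
    by (intro sigma_sets.Compl sigma_sets.Basic) simp
  with \<open>C \<subseteq> M\<close> show ?thesis
    by (simp add: sets_borel_metric[OF M] double_diff)
qed

text \<open>
  The projection is continuous, and the right-continuous inverse is monotone, hence Borel.
\<close>

lemma measurable_code:
  assumes M: "Metric_space M d" and p: "continuous_map (top_of_set {0..1}) (Metric_space.mtopology M d) p"
    and N: "sets N = sets (borel_metric M d)"
  shows "(\<lambda>u. p (right_inverse tau u)) \<in> measurable (restrict_space lborel {0..1}) N"
proof -
  interpret Metric_space M d by (rule M)
  have "(\<lambda>u. p (right_inverse tau u)) \<in> measurable (restrict_space lborel {0..1}) (borel_metric M d)"
  proof (rule measurable_sigma_sets[OF sets_borel_metric(1,3)[OF M]])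
    show "(\<lambda>u. p (right_inverse tau u)) \<in> space (restrict_space lborel {0..1}) \<rightarrow> M"
      using p right_inverse_unit unfolding continuous_map_def by force
    fix U assume "U \<in> {U. openin mtopology U}"
    then have "openin (top_of_set {0..1}) {s \<in> {0..1}. p s \<in> U}"
      using p by (auto simp: continuous_map_def)
    then obtain T where T: "open T" "{s \<in> {0..1}. p s \<in> U} = {0..1} \<inter> T"
      by (auto simp: openin_open)
    have "(\<lambda>u. p (right_inverse tau u)) -` U \<inter> space (restrict_space lborel {0..1}) =
        {0..1} \<inter> (right_inverse tau -` T)"
      using T(2) right_inverse_unit[of tau] by auto
    moreover have "right_inverse tau -` T \<in> sets borel"
      using measurable_sets[OF borel_measurable_mono[OF mono_right_inverse], of T tau] T(1) by simp
    ultimately show "(\<lambda>u. p (right_inverse tau u)) -` U \<inter> space (restrict_space lborel {0..1})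
        \<in> sets (restrict_space lborel {0..1})"
      by (auto simp: sets_restrict_space)
  qed
  then show ?thesis using N measurable_cong_sets by blast
qed

lemma equiv_tree_rel:
  assumes "continuous_on {0..1} f"
  shows "equiv {0..1} (tree_rel f)"
proof (rule equivI)
  show "trans (tree_rel f)"
  proof (rule transI)
    fix s t u assume "(s, t) \<in> tree_rel f" "(t, u) \<in> tree_rel f"
    then show "(s, u) \<in> tree_rel f"
      using tree_pdist_triangle[OF assms, of s t u] tree_pdist_nonneg[OF assms, of s u]
      by (simp add: tree_rel_def)
  qed
qed (auto simp: tree_rel_def refl_on_def sym_def tree_pdist_refl tree_pdist_commute)

text \<open>
  The distance of the quotient is defined through chosen representatives; by the triangle inequality
  they may be replaced by any others.
\<close>

lemma tree_dist_proj:
  assumes f: "continuous_on {0..1} f" and s: "s \<in> {0..1}" and t: "t \<in> {0..1}"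
  shows "tree_dist f (tree_proj f s) (tree_proj f t) = tree_pdist f s t"
proof -
  have some: "(SOME a. a \<in> tree_proj f r) \<in> {0..1}" "tree_pdist f r (SOME a. a \<in> tree_proj f r) = 0"
    if r: "r \<in> {0..1}" for r
  proof -
    have "r \<in> tree_proj f r"
      using r by (auto simp: tree_proj_def tree_rel_def tree_pdist_refl)
    then have "(SOME a. a \<in> tree_proj f r) \<in> tree_proj f r" by (rule someI)
    then show "(SOME a. a \<in> tree_proj f r) \<in> {0..1}" "tree_pdist f r (SOME a. a \<in> tree_proj f r) = 0"
      by (auto simp: tree_proj_def tree_rel_def)
  qed
  define s' where "s' = (SOME a. a \<in> tree_proj f s)"
  define t' where "t' = (SOME a. a \<in> tree_proj f t)"
  have s': "s' \<in> {0..1}" "tree_pdist f s s' = 0" and t': "t' \<in> {0..1}" "tree_pdist f t t' = 0"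
    using some[OF s] some[OF t] by (auto simp: s'_def t'_def)
  have "tree_proj f s \<in> tree_points f" "tree_proj f t \<in> tree_points f"
    using s t by (auto simp: tree_points_def tree_proj_def intro: quotientI)
  then have "tree_dist f (tree_proj f s) (tree_proj f t) = tree_pdist f s' t'"
    by (simp add: tree_dist_def s'_def t'_def)
  also have "\<dots> = tree_pdist f s t"
    using tree_pdist_triangle[OF f s s'(1) t] tree_pdist_triangle[OF f s'(1) t'(1) t]
      tree_pdist_triangle[OF f s'(1) s t'(1)] tree_pdist_triangle[OF f s t t'(1)] s'(2) t'(2)
      tree_pdist_commute[of f s' s] tree_pdist_commute[of f t' t]
    by linarith
  finally show ?thesis .
qed

lemma tree_points_proj: "tree_points f = tree_proj f ` {0..1}"
  by (auto simp: tree_points_def tree_proj_def quotient_def)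

lemma coded_tree:
  assumes f: "continuous_on {0..1} f"
  shows "coded_tree (f, tau) \<in> mrc_spaces" "codes f tau (tree_proj f) (coded_tree (f, tau))"
proof -
  have M: "Metric_space (tree_points f) (tree_dist f)"
  proof
    fix A B :: "real set"
    show "0 \<le> tree_dist f A B"
    proof (cases "A \<in> tree_points f \<and> B \<in> tree_points f")
      case True
      then show ?thesis
        by (auto simp: tree_points_proj tree_dist_proj[OF f] tree_pdist_nonneg[OF f])
    qed (auto simp: tree_dist_def)
    show "tree_dist f A B = tree_dist f B A"
      by (simp add: tree_dist_def tree_pdist_commute)
  next
    fix A B assume "A \<in> tree_points f" "B \<in> tree_points f"
    then obtain s t where st: "s \<in> {0..1}" "t \<in> {0..1}" "A = tree_proj f s" "B = tree_proj f t"
      by (auto simp: tree_points_proj)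
    have "tree_proj f s = tree_proj f t \<longleftrightarrow> (s, t) \<in> tree_rel f"
      using eq_equiv_class_iff[OF equiv_tree_rel[OF f] st(1,2)] by (simp add: tree_proj_def)
    then show "tree_dist f A B = 0 \<longleftrightarrow> A = B"
      using st by (simp add: tree_dist_proj[OF f] tree_rel_def)
  next
    fix A B C assume "A \<in> tree_points f" "B \<in> tree_points f" "C \<in> tree_points f"
    then show "tree_dist f A C \<le> tree_dist f A B + tree_dist f B C"
      by (auto simp: tree_points_proj tree_dist_proj[OF f] intro!: tree_pdist_triangle[OF f])
  qed
  then interpret Metric_space "tree_points f" "tree_dist f" .
  have p: "continuous_map (top_of_set {0..1}) mtopology (tree_proj f)"
    by (rule continuous_map_into_tree[OF M f]) (auto simp: tree_points_proj tree_dist_proj[OF f])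
  have "compactin mtopology (tree_proj f ` {0..1})"
    by (rule image_compactin[OF _ p]) (simp add: compactin_subtopology)
  then have K: "compact_space mtopology"
    by (simp add: compact_space_def flip: tree_points_proj)
  have meas: "(\<lambda>u. tree_proj f (right_inverse tau u))
      \<in> measurable (restrict_space lborel {0..1}) (borel_metric (tree_points f) (tree_dist f))"
    by (rule measurable_code[OF M p refl])
  have root: "tree_proj f 0 \<in> tree_points f" by (simp add: tree_points_proj)
  have "prob_space (tree_measure f tau)"
    unfolding tree_measure_def by (rule prob_space.prob_space_distr[OF prob_space_unit_lborel meas])
  then show "coded_tree (f, tau) \<in> mrc_spaces"
    using M K root sets_borel_metric(2)[OF M]
    by (simp add: mrc_spaces_def coded_tree_def tree_measure_def)
  show "codes f tau (tree_proj f) (coded_tree (f, tau))"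
    using tree_dist_proj[OF f]
    by (auto simp: codes_def coded_tree_def tree_points_proj tree_measure_def cong: distr_cong)
qed

text \<open>
  The image measure under a map is only meaningful when the map is measurable, which the notion of
  isometry of measured spaces leaves to be proved. It follows from continuity.
\<close>

lemma measurable_isometry:
  assumes K: "K \<in> mrc_spaces" and L: "L \<in> mrc_spaces"
    and f: "f \<in> points K \<rightarrow> points L"
    and d: "\<And>y z. y \<in> points K \<Longrightarrow> z \<in> points K \<Longrightarrow> mdist L (f y) (f z) = mdist K y z"
  shows "f \<in> measurable (mmeas K) (mmeas L)"
proof -
  from K L have metK: "Metric_space (points K) (mdist K)" and metL: "Metric_space (points L) (mdist L)"
    and sK: "sets (mmeas K) = sets (borel_metric (points K) (mdist K))"
    and sL: "sets (mmeas L) = sets (borel_metric (points L) (mdist L))"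
    by (auto simp: mrc_spaces_def)
  interpret K: Metric_space "points K" "mdist K" by (rule metK)
  interpret L: Metric_space "points L" "mdist L" by (rule metL)
  have c: "continuous_map K.mtopology L.mtopology f"
    unfolding L.continuous_map_to_metric
  proof (intro ballI allI impI)
    fix y e :: real and a assume a: "a \<in> topspace K.mtopology" and e: "0 < e"
    have "\<forall>b\<in>K.mball a e. f b \<in> L.mball (f a) e"
      using a f d by auto
    then show "\<exists>U. openin K.mtopology U \<and> a \<in> U \<and> (\<forall>y\<in>U. f y \<in> L.mball (f a) e)"
      using a e by (intro exI[of _ "K.mball a e"]) auto
  qed
  have "f \<in> measurable (borel_metric (points K) (mdist K)) (borel_metric (points L) (mdist L))"
  proof (rule measurable_sigma_sets[OF sets_borel_metric(1,3)[OF metL]])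
    show "f \<in> space (borel_metric (points K) (mdist K)) \<rightarrow> points L"
      using f by (simp add: sets_borel_metric[OF metK])
    fix U assume "U \<in> {U. openin L.mtopology U}"
    then have "openin K.mtopology {y \<in> points K. f y \<in> U}"
      using c by (auto simp: continuous_map_def)
    moreover have "f -` U \<inter> space (borel_metric (points K) (mdist K)) = {y \<in> points K. f y \<in> U}"
      by (auto simp: sets_borel_metric[OF metK])
    ultimately show "f -` U \<inter> space (borel_metric (points K) (mdist K))
        \<in> sets (borel_metric (points K) (mdist K))"
      by (simp add: sets_borel_metric[OF metK])
  qed
  then show ?thesis using sK sL measurable_cong_sets by blast
qed

lemma codes_continuous_map:
  assumes "continuous_on {0..1} chi" "K \<in> mrc_spaces" "codes chi tau p K"
  shows "continuous_map (top_of_set {0..1}) (Metric_space.mtopology (points K) (mdist K)) p"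
  using assms by (intro continuous_map_into_tree[where chi = chi])
    (auto simp: mrc_spaces_def codes_def)

lemma codes_measurable:
  assumes "continuous_on {0..1} chi" "K \<in> mrc_spaces" "codes chi tau p K"
  shows "(\<lambda>u. p (right_inverse tau u)) \<in> measurable (restrict_space lborel {0..1}) (mmeas K)"
  using assms codes_continuous_map[OF assms]
  by (intro measurable_code) (auto simp: mrc_spaces_def)

lemma codes_isometric_image:
  assumes chi: "continuous_on {0..1} chi" and K: "K \<in> mrc_spaces" and L: "L \<in> mrc_spaces"
    and p: "codes chi tau p K" and iso: "mr_isometric K L"
  shows "\<exists>q. codes chi tau q L"
proof -
  obtain f where f: "bij_betw f (points K) (points L)"
    "\<And>y z. y \<in> points K \<Longrightarrow> z \<in> points K \<Longrightarrow> mdist L (f y) (f z) = mdist K y z"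
    "f (mroot K) = mroot L" "distr (mmeas K) (mmeas L) f = mmeas L"
    using iso by (auto simp: mr_isometric_def)
  have mf: "f \<in> measurable (mmeas K) (mmeas L)"
    using f(1,2) by (intro measurable_isometry[OF K L]) (auto simp: bij_betw_def)
  have "distr (restrict_space lborel {0..1}) (mmeas L) (\<lambda>u. f (p (right_inverse tau u)))
      = distr (distr (restrict_space lborel {0..1}) (mmeas K) (\<lambda>u. p (right_inverse tau u))) (mmeas L) f"
    by (subst distr_distr[OF mf codes_measurable[OF chi K p]]) (simp add: o_def)
  also have "\<dots> = mmeas L" using p f(4) by (simp add: codes_def)
  finally have "distr (restrict_space lborel {0..1}) (mmeas L) (\<lambda>u. f (p (right_inverse tau u))) = mmeas L" .
  then have "codes chi tau (\<lambda>s. f (p s)) L"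
    unfolding codes_def
  proof (intro conjI ballI)
    show "(\<lambda>s. f (p s)) ` {0..1} = points L"
      using p f(1) by (simp add: codes_def bij_betw_def flip: image_image)
    show "mdist L (f (p s)) (f (p t)) = tree_pdist chi s t" if "s \<in> {0..1}" "t \<in> {0..1}" for s t
    proof -
      have "p s \<in> points K" "p t \<in> points K" using p that by (auto simp: codes_def)
      then show ?thesis using p that f(2) by (simp add: codes_def)
    qed
    show "f (p 0) = mroot L" using p f(3) by (simp add: codes_def)
  qed
  then show ?thesis by blast
qed

text \<open>
  The isometry sends the point of \<open>K\<close> with parameter \<open>s\<close> to the point of \<open>L\<close> with the same parameter. The
  choice of \<open>s\<close> is harmless, since parameters of the same point have pseudo-distance 0.
\<close>

lemma codes_unique:
  assumes chi: "continuous_on {0..1} chi" and K: "K \<in> mrc_spaces" and L: "L \<in> mrc_spaces"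
    and p: "codes chi tau p K" and q: "codes chi tau q L"
  shows "mr_isometric K L"
proof -
  interpret metK: Metric_space "points K" "mdist K" using K by (simp add: mrc_spaces_def)
  interpret metL: Metric_space "points L" "mdist L" using L by (simp add: mrc_spaces_def)
  define h where "h a = (SOME s. s \<in> {0..1} \<and> p s = a)" for a
  define f where "f a = q (h a)" for a
  have h: "h a \<in> {0..1}" "p (h a) = a" if "a \<in> points K" for a
  proof -
    have "\<exists>s. s \<in> {0..1} \<and> p s = a" using that p unfolding codes_def by (metis imageE)
    from someI_ex[OF this] show "h a \<in> {0..1}" "p (h a) = a" by (simp_all add: h_def)
  qed
  have pK: "p s \<in> points K" and qL: "q s \<in> points L" if "s \<in> {0..1}" for s
    using that p q by (auto simp: codes_def)
  have dp: "mdist K (p s) (p t) = tree_pdist chi s t" and dq: "mdist L (q s) (q t) = tree_pdist chi s t"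
    if "s \<in> {0..1}" "t \<in> {0..1}" for s t
    using that p q by (auto simp: codes_def)
  have fp: "f (p s) = q s" if s: "s \<in> {0..1}" for s
  proof -
    have "mdist L (q (h (p s))) (q s) = mdist K (p (h (p s))) (p s)"
      using s dp dq h(1)[OF pK[OF s]] by metis
    also have "\<dots> = 0" using h(2)[OF pK[OF s]] pK[OF s] by simp
    finally show ?thesis using qL s h(1)[OF pK[OF s]] by (simp add: f_def)
  qed
  have iso: "mdist L (f y) (f z) = mdist K y z" if "y \<in> points K" "z \<in> points K" for y z
    using that h dp[of "h y" "h z"] dq[of "h y" "h z"] by (simp add: f_def)
  have im: "f ` points K = points L"
  proof -
    have "f ` p ` {0..1} = q ` {0..1}" using fp by (simp add: image_image)
    then show ?thesis using p q by (simp add: codes_def)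
  qed
  have "inj_on f (points K)"
  proof (rule inj_onI)
    fix y z assume yz: "y \<in> points K" "z \<in> points K" "f y = f z"
    then have "mdist K y z = 0" using iso[of y z] im by (metis metL.zero imageI)
    with yz show "y = z" by simp
  qed
  moreover have "f (mroot K) = mroot L" using fp[of 0] p q by (simp add: codes_def)
  moreover have "distr (mmeas K) (mmeas L) f = mmeas L"
  proof -
    have mf: "f \<in> measurable (mmeas K) (mmeas L)"
      using im iso by (intro measurable_isometry[OF K L]) auto
    have "distr (mmeas K) (mmeas L) f
        = distr (distr (restrict_space lborel {0..1}) (mmeas K) (\<lambda>u. p (right_inverse tau u))) (mmeas L) f"
      using p by (simp add: codes_def)
    also have "\<dots> = distr (restrict_space lborel {0..1}) (mmeas L) (\<lambda>u. q (right_inverse tau u))"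
      by (subst distr_distr[OF mf codes_measurable[OF chi K p]])
        (use fp right_inverse_unit in \<open>auto simp: o_def intro!: distr_cong\<close>)
    also have "\<dots> = mmeas L" using q by (simp add: codes_def)
    finally show ?thesis .
  qed
  ultimately show ?thesis
    using im iso unfolding mr_isometric_def bij_betw_def by blast
qed

section \<open>Independence of the parametric representation\<close>

text \<open>
  At a fixed time the graph is a segment that starts at the left limit, so the distance to the left
  limit determines the point.
\<close>

lemma graph_le_antisym:
  assumes p: "p \<in> completed_graph x" and q: "q \<in> completed_graph x"
    and pq: "graph_le x p q" and qp: "graph_le x q p"
  shows "p = q"
proof -
  obtain t l where p': "p = (l * left_limit x t + (1 - l) * x t, t)" "l \<in> {0..1}"
    using p by (auto simp: completed_graph_def)
  obtain t' k where q': "q = (k * left_limit x t' + (1 - k) * x t', t')" "k \<in> {0..1}"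
    using q by (auto simp: completed_graph_def)
  have t: "t' = t" using pq qp p' q' by (auto simp: graph_le_def)
  have *: "\<bar>a * left_limit x t + (1 - a) * x t - left_limit x t\<bar> = (1 - a) * \<bar>x t - left_limit x t\<bar>"
    if "a \<in> {0..1}" for a
  proof -
    have "a * left_limit x t + (1 - a) * x t - left_limit x t = (1 - a) * (x t - left_limit x t)"
      by (simp add: algebra_simps)
    then show ?thesis using that by (simp add: abs_mult)
  qed
  have "(1 - l) * \<bar>x t - left_limit x t\<bar> = (1 - k) * \<bar>x t - left_limit x t\<bar>"
    using pq qp p' q' t *[of l] *[of k] by (auto simp: graph_le_def)
  then have "l = k \<or> x t = left_limit x t" by auto
  then show ?thesis using p' q' t by (auto simp: algebra_simps)
qed

context
  fixes x chi tau
  assumes rep: "(chi, tau) \<in> param_reps x"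
begin

lemma param_rep_conds:
  "continuous_on {0..1} (\<lambda>s. (chi s, tau s))"
  "(\<lambda>s. (chi s, tau s)) ` {0..1} = completed_graph x"
  "\<forall>s\<in>{0..1}. \<forall>t\<in>{0..1}. s \<le> t \<longrightarrow> graph_le x (chi s, tau s) (chi t, tau t)"
  using rep unfolding param_reps_def mem_Collect_eq prod.case by blast+

lemma param_rep_continuous: "continuous_on {0..1} chi" "continuous_on {0..1} tau"
  using continuous_on_fst[OF param_rep_conds(1)] continuous_on_snd[OF param_rep_conds(1)]
  by (simp_all only: fst_conv snd_conv)

lemma param_rep_mem: "s \<in> {0..1} \<Longrightarrow> (chi s, tau s) \<in> completed_graph x"
  unfolding param_rep_conds(2)[symmetric] by (rule imageI)

lemma param_rep_onto:
  assumes "p \<in> completed_graph x"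
  obtains s where "s \<in> {0..1}" "(chi s, tau s) = p"
  using assms that unfolding param_rep_conds(2)[symmetric] by (elim imageE) blast

lemma param_rep_mono:
  "s \<in> {0..1} \<Longrightarrow> t \<in> {0..1} \<Longrightarrow> s \<le> t \<Longrightarrow> graph_le x (chi s, tau s) (chi t, tau t)"
  using param_rep_conds(3) by blast

lemma param_rep_tau_mono: "s \<in> {0..1} \<Longrightarrow> t \<in> {0..1} \<Longrightarrow> s \<le> t \<Longrightarrow> tau s \<le> tau t"
  using param_rep_mono[of s t] by (auto simp: graph_le_def)

text \<open>
  The graph points visited between two parameters form an order interval of the graph, so they depend only
  on the two end points. A point of that interval visited outside the parameter interval equals one of
  the end points by antisymmetry. Both orders of the end points are allowed so that no comparison of
  \<open>s\<close> and \<open>t\<close> is needed.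
\<close>

lemma param_rep_image_interval:
  assumes s: "s \<in> {0..1}" and t: "t \<in> {0..1}"
  shows "(\<lambda>r. (chi r, tau r)) ` {min s t..max s t} = {p \<in> completed_graph x.
     graph_le x (chi s, tau s) p \<and> graph_le x p (chi t, tau t) \<or>
     graph_le x (chi t, tau t) p \<and> graph_le x p (chi s, tau s)}" (is "?L = ?R")
proof
  show "?L \<subseteq> ?R"
  proof
    fix p assume "p \<in> ?L"
    then obtain r where r: "r \<in> {min s t..max s t}" "p = (chi r, tau r)" by auto
    then have "r \<in> {0..1}" using s t by auto
    then show "p \<in> ?R"
      using r s t param_rep_mem[of r] param_rep_mono by (cases "s \<le> t") auto
  qed
  show "?R \<subseteq> ?L"
  proof
    fix p assume p: "p \<in> ?R"
    then obtain r where r: "r \<in> {0..1}" "(chi r, tau r) = p"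
      using param_rep_onto[of p] by auto
    consider "r \<in> {min s t..max s t}" | "r < min s t" | "max s t < r" by force
    then show "p \<in> ?L"
    proof cases
      case 1
      then show ?thesis using r by auto
    next
      case 2
      then have "graph_le x p (chi s, tau s)" "graph_le x p (chi t, tau t)"
        using r s t param_rep_mono[of r s] param_rep_mono[of r t] by auto
      then have "p = (chi s, tau s) \<or> p = (chi t, tau t)"
        using p graph_le_antisym param_rep_mem[OF s] param_rep_mem[OF t] by blast
      moreover have "s \<in> {min s t..max s t}" "t \<in> {min s t..max s t}" by auto
      ultimately show ?thesis by blast
    next
      case 3
      then have "graph_le x (chi s, tau s) p" "graph_le x (chi t, tau t) p"
        using r s t param_rep_mono[of s r] param_rep_mono[of t r] by auto
      then have "p = (chi s, tau s) \<or> p = (chi t, tau t)"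
        using p graph_le_antisym param_rep_mem[OF s] param_rep_mem[OF t] by blast
      moreover have "s \<in> {min s t..max s t}" "t \<in> {min s t..max s t}" by auto
      ultimately show ?thesis by blast
    qed
  qed
qed

text \<open>
  The right-continuous inverse picks the last parameter at time \<open>u\<close>, and the largest point of the graph at
  that time is \<open>(x u, u)\<close>. This is why the mass measure is the same for all representations.
\<close>

lemma param_rep_right_inverse:
  assumes u: "u \<in> {0..1}"
  shows "tau (right_inverse tau u) = u" "chi (right_inverse tau u) = x u"
proof -
  define r where "r = right_inverse tau u"
  have r: "r \<in> {0..1}" by (simp only: r_def right_inverse_unit)
  have "(x u, u) \<in> completed_graph x"
    using u by (auto simp: completed_graph_def intro!: exI[of _ 0])
  then obtain s where s: "s \<in> {0..1}" "chi s = x u" "tau s = u"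
    using param_rep_onto[of "(x u, u)"] by auto
  have sr: "s \<le> r"
    unfolding r_def right_inverse_def
  proof (rule cInf_greatest)
    fix v assume v: "v \<in> insert 1 {v \<in> {0..1}. u < tau v}"
    show "s \<le> v"
    proof (rule ccontr)
      assume "\<not> s \<le> v"
      with v s have "u < tau v" "v \<in> {0..1}" "v \<le> s" by auto
      with s(3) param_rep_tau_mono[OF _ s(1), of v] show False by auto
    qed
  qed auto
  have least: "r \<le> v" if "v \<in> {0..1}" "u < tau v" for v
    unfolding r_def right_inverse_def using that
    by (intro cInf_lower) (auto intro: bdd_belowI[of _ 0])
  \<comment> \<open>If \<open>tau\<close> had already exceeded \<open>u\<close> at the infimum, continuity would make it exceed \<open>u\<close> earlier.\<close>
  have tau: "tau r = u"
  proof (rule ccontr)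
    assume "tau r \<noteq> u"
    then have gt: "u < tau r" using param_rep_tau_mono[OF s(1) r sr] s(3) by simp
    have "\<exists>v. s \<le> v \<and> v \<le> r \<and> tau v = (u + tau r) / 2"
      using param_rep_continuous(2) gt s r sr
      by (intro IVT') (auto intro: continuous_on_subset)
    then obtain v where v: "s \<le> v" "v \<le> r" "tau v = (u + tau r) / 2" by blast
    then have "r \<le> v" using gt s r by (intro least) auto
    with v gt show False by simp
  qed
  then show "tau (right_inverse tau u) = u" by (simp add: r_def)
  have "(chi r, tau r) = (x u, u)"
  proof (rule graph_le_antisym)
    show "graph_le x (x u, u) (chi r, tau r)" using param_rep_mono[OF s(1) r sr] s by simp
    obtain l where l: "l \<in> {0..1}" "chi r = l * left_limit x u + (1 - l) * x u"
      using param_rep_mem[OF r] tau by (auto simp: completed_graph_def)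
    have "\<bar>chi r - left_limit x u\<bar> = \<bar>(1 - l) * (x u - left_limit x u)\<bar>"
      using l(2) by (simp add: algebra_simps)
    also have "\<dots> \<le> \<bar>x u - left_limit x u\<bar>"
      using l(1) by (auto simp: abs_mult intro: mult_left_le_one_le)
    finally show "graph_le x (chi r, tau r) (x u, u)" using tau by (simp add: graph_le_def)
  qed (use param_rep_mem r s(1) s(2,3) param_rep_mem[OF s(1)] in auto)
  then show "chi (right_inverse tau u) = x u" by (simp add: r_def)
qed

end

text \<open>
  Applied with \<open>(chi', tau') = (chi, tau)\<close>, this also says that parameters of the same graph point code the
  same point of the tree.
\<close>

lemma tree_pdist_param_rep:
  assumes rep: "(chi, tau) \<in> param_reps x" and rep': "(chi', tau') \<in> param_reps x"
    and st: "s \<in> {0..1}" "t \<in> {0..1}" and st': "s' \<in> {0..1}" "t' \<in> {0..1}"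
    and s: "(chi' s', tau' s') = (chi s, tau s)" and t: "(chi' t', tau' t') = (chi t, tau t)"
  shows "tree_pdist chi' s' t' = tree_pdist chi s t"
proof -
  have "(\<lambda>r. (chi' r, tau' r)) ` {min s' t'..max s' t'} = (\<lambda>r. (chi r, tau r)) ` {min s t..max s t}"
    by (simp only: param_rep_image_interval[OF rep st] param_rep_image_interval[OF rep' st'] s t)
  then have "fst ` (\<lambda>r. (chi' r, tau' r)) ` {min s' t'..max s' t'}
      = fst ` (\<lambda>r. (chi r, tau r)) ` {min s t..max s t}"
    by simp
  then have "chi' ` {min s' t'..max s' t'} = chi ` {min s t..max s t}"
    by (simp only: image_image fst_conv)
  with s t show ?thesis by (simp add: tree_pdist_def)
qed

text \<open>
  A parameter of the new representation is first sent to any parameter \<open>g s'\<close> at which the old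
  representation visits the same graph point. The choice need be neither monotone nor continuous.
\<close>

lemma codes_param_rep:
  assumes rep: "(chi, tau) \<in> param_reps x" and rep': "(chi', tau') \<in> param_reps x"
    and K: "K \<in> mrc_spaces" and p: "codes chi tau p K"
  shows "\<exists>q. codes chi' tau' q K"
proof -
  interpret Metric_space "points K" "mdist K" using K by (simp add: mrc_spaces_def)
  have dp: "mdist K (p s) (p t) = tree_pdist chi s t" if "s \<in> {0..1}" "t \<in> {0..1}" for s t
    using that p by (auto simp: codes_def)
  have pK: "p s \<in> points K" if "s \<in> {0..1}" for s
    using that p by (auto simp: codes_def)
  have "\<exists>s. s \<in> {0..1} \<and> (chi s, tau s) = (chi' s', tau' s')" if "s' \<in> {0..1}" for s'
    using param_rep_onto[OF rep param_rep_mem[OF rep' that]] by metis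
  then obtain g where g: "\<And>s'. s' \<in> {0..1} \<Longrightarrow> g s' \<in> {0..1}"
    "\<And>s'. s' \<in> {0..1} \<Longrightarrow> (chi (g s'), tau (g s')) = (chi' s', tau' s')"
    by metis
  have glue: "p (g s') = p s"
    if "s' \<in> {0..1}" "s \<in> {0..1}" "(chi' s', tau' s') = (chi s, tau s)" for s s'
  proof -
    have "tree_pdist chi (g s') s = tree_pdist chi s s"
      using that g by (intro tree_pdist_param_rep[OF rep rep]) auto
    then show ?thesis
      using dp[of "g s'" s] pK[of "g s'"] pK[of s] g that by (simp add: tree_pdist_refl)
  qed
  have "codes chi' tau' (\<lambda>s'. p (g s')) K"
    unfolding codes_def
  proof (intro conjI ballI)
    show "(\<lambda>s'. p (g s')) ` {0..1} = points K"
    proof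
      show "(\<lambda>s'. p (g s')) ` {0..1} \<subseteq> points K" using g(1) pK by blast
      show "points K \<subseteq> (\<lambda>s'. p (g s')) ` {0..1}"
      proof
        fix a assume "a \<in> points K"
        then obtain s where s: "s \<in> {0..1}" "a = p s" using p unfolding codes_def by blast
        obtain s' where "s' \<in> {0..1}" "(chi' s', tau' s') = (chi s, tau s)"
          using param_rep_onto[OF rep' param_rep_mem[OF rep s(1)]] by metis
        then show "a \<in> (\<lambda>s'. p (g s')) ` {0..1}" using glue s by (intro rev_image_eqI[of s']) auto
      qed
    qed
    show "mdist K (p (g s)) (p (g t)) = tree_pdist chi' s t" if st: "s \<in> {0..1}" "t \<in> {0..1}" for s t
      using dp[OF g(1)[OF st(1)] g(1)[OF st(2)]]
        tree_pdist_param_rep[OF rep' rep st g(1)[OF st(1)] g(1)[OF st(2)] g(2)[OF st(1)] g(2)[OF st(2)]]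
      by simp
    show "p (g 0) = mroot K"
    proof -
      have "(chi' 0, tau' 0) = (chi 0, tau 0)"
      proof (rule graph_le_antisym[OF param_rep_mem[OF rep'] param_rep_mem[OF rep]])
        show "graph_le x (chi' 0, tau' 0) (chi 0, tau 0)"
          using param_rep_onto[OF rep' param_rep_mem[OF rep, of 0]] param_rep_mono[OF rep', of 0]
          by (metis atLeastAtMost_iff order_refl zero_le_one)
        show "graph_le x (chi 0, tau 0) (chi' 0, tau' 0)"
          using g(1)[of 0] g(2)[of 0] param_rep_mono[OF rep, of 0 "g 0"] by simp
      qed auto
      then show ?thesis using glue[of 0 0] p by (simp add: codes_def)
    qed
    have "p (g (right_inverse tau' u)) = p (right_inverse tau u)" if "u \<in> {0..1}" for u
      using param_rep_right_inverse[OF rep that] param_rep_right_inverse[OF rep' that]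
      by (intro glue right_inverse_unit) simp
    then show "distr (restrict_space lborel {0..1}) (mmeas K) (\<lambda>u. p (g (right_inverse tau' u))) = mmeas K"
      using p unfolding codes_def
      by (subst distr_cong[where g = "\<lambda>u. p (right_inverse tau u)"]) auto
  qed
  then show ?thesis by blast
qed

section \<open>Oscillation and jumps of cadlag functions\<close>

lemma left_limit_tendsto:
  assumes "cadlag x" "t \<in> {0<..1}"
  shows "(x \<longlongrightarrow> left_limit x t) (at_left t)"
proof -
  obtain l where l: "(x \<longlongrightarrow> l) (at_left t)" using assms unfolding cadlag_def by blast
  moreover have "Lim (at_left t) x = l"
    using l by (intro tendsto_Lim) (simp_all add: trivial_limit_at_left_real)
  ultimately show ?thesis using assms(2) by (simp add: left_limit_def)
qed

lemma left_limit_bound: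
  assumes x: "cadlag x" and t: "t \<in> {0..1}" and a: "a < t"
    and b: "\<And>s. s \<in> {0..1} \<Longrightarrow> a < s \<Longrightarrow> s \<le> t \<Longrightarrow> \<bar>x s - c\<bar> \<le> e"
  shows "\<bar>left_limit x t - c\<bar> \<le> e"
proof (cases "t = 0")
  case True
  then show ?thesis using b[of 0] a by (simp add: left_limit_def)
next
  case False
  then have "((\<lambda>s. \<bar>x s - c\<bar>) \<longlongrightarrow> \<bar>left_limit x t - c\<bar>) (at_left t)"
    using t by (intro tendsto_intros left_limit_tendsto[OF x]) auto
  moreover have "eventually (\<lambda>s. \<bar>x s - c\<bar> \<le> e) (at_left t)"
    using eventually_at_left_real[of "max a 0" t] a t False
    by (auto elim!: eventually_mono intro!: b)
  ultimately show ?thesis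
    by (rule tendsto_upperbound) (simp add: trivial_limit_at_left_real)
qed

lemma cadlag_near:
  assumes x: "cadlag x" and c: "c \<in> {0..1}" and e: "0 < e"
  obtains d where "0 < d"
    "\<And>t. t \<in> {0..1} \<Longrightarrow> c < t \<Longrightarrow> t < c + d \<Longrightarrow>
       \<bar>x t - x c\<bar> \<le> e \<and> \<bar>left_limit x t - x c\<bar> \<le> e"
    "\<And>t. t \<in> {0..1} \<Longrightarrow> c - d < t \<Longrightarrow> t < c \<Longrightarrow>
       \<bar>x t - left_limit x c\<bar> \<le> e \<and> \<bar>left_limit x t - left_limit x c\<bar> \<le> e"
proof -
  have "\<exists>b>c. \<forall>t\<in>{0..1}. c < t \<longrightarrow> t < b \<longrightarrow> \<bar>x t - x c\<bar> \<le> e"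
  proof (cases "c = 1")
    case True
    then show ?thesis by (intro exI[of _ 2]) auto
  next
    case False
    then have "(x \<longlongrightarrow> x c) (at_right c)" using x c by (auto simp: cadlag_def continuous_within)
    then have "eventually (\<lambda>t. \<bar>x t - x c\<bar> < e) (at_right c)"
      using e tendstoD by (fastforce simp: dist_real_def)
    then show ?thesis by (auto simp: eventually_at_right_field intro: less_imp_le)
  qed
  then obtain b where b: "c < b" "\<And>t. t \<in> {0..1} \<Longrightarrow> c < t \<Longrightarrow> t < b \<Longrightarrow> \<bar>x t - x c\<bar> \<le> e"
    by blast
  have "\<exists>a<c. \<forall>t\<in>{0..1}. a < t \<longrightarrow> t < c \<longrightarrow> \<bar>x t - left_limit x c\<bar> \<le> e"
  proof (cases "c = 0")
    case True
    then show ?thesis by (intro exI[of _ "-1"]) auto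
  next
    case False
    then have "eventually (\<lambda>t. \<bar>x t - left_limit x c\<bar> < e) (at_left c)"
      using tendstoD[OF left_limit_tendsto[OF x, of c] e] c by (simp add: dist_real_def)
    then show ?thesis by (auto simp: eventually_at_left_field intro: less_imp_le)
  qed
  then obtain a where a: "a < c"
    "\<And>t. t \<in> {0..1} \<Longrightarrow> a < t \<Longrightarrow> t < c \<Longrightarrow> \<bar>x t - left_limit x c\<bar> \<le> e"
    by blast
  show thesis
  proof (rule that[of "min (b - c) (c - a)"])
    show "0 < min (b - c) (c - a)" using a b by simp
    fix t :: real assume t: "t \<in> {0..1}"
    show "\<bar>x t - x c\<bar> \<le> e \<and> \<bar>left_limit x t - x c\<bar> \<le> e"
      if "c < t" "t < c + min (b - c) (c - a)"
      using that t b(2) by (auto intro!: left_limit_bound[OF x t that(1)])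
    show "\<bar>x t - left_limit x c\<bar> \<le> e \<and> \<bar>left_limit x t - left_limit x c\<bar> \<le> e"
      if "c - min (b - c) (c - a) < t" "t < c"
      using that t a(2) by (auto intro!: left_limit_bound[OF x t, of a])
  qed
qed

text \<open>
  On either side of each time the function has a limit, so its oscillation is small on the two
  one-sided neighbourhoods once the time itself is removed; compactness, in the form of bisection,
  leaves finitely many removed times.
\<close>

lemma cadlag_finite_partition:
  assumes x: "cadlag x" and e: "0 < e"
  obtains F where "finite F"
    "\<And>s t. s \<in> {0..1} \<Longrightarrow> t \<in> {0..1} \<Longrightarrow> s \<le> t \<Longrightarrow> {s..t} \<inter> F = {} \<Longrightarrow> \<bar>x s - x t\<bar> \<le> e"
proof -
  define P where "P a b \<longleftrightarrow> (\<exists>F. finite F \<and> (\<forall>s t. s \<in> {0..1} \<longrightarrow> t \<in> {0..1} \<longrightarrow> a \<le> s \<longrightarrow> s \<le> t \<longrightarrow>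
     t \<le> b \<longrightarrow> {s..t} \<inter> F = {} \<longrightarrow> \<bar>x s - x t\<bar> \<le> e))" for a b
  have "P 0 1"
  proof (rule Bolzano)
    fix a b c assume "P a b" "P b c"
    then obtain F G where F: "finite F" "\<And>s t. s \<in> {0..1} \<Longrightarrow> t \<in> {0..1} \<Longrightarrow> a \<le> s \<Longrightarrow> s \<le> t \<Longrightarrow> t \<le> b \<Longrightarrow>
        {s..t} \<inter> F = {} \<Longrightarrow> \<bar>x s - x t\<bar> \<le> e"
      and G: "finite G" "\<And>s t. s \<in> {0..1} \<Longrightarrow> t \<in> {0..1} \<Longrightarrow> b \<le> s \<Longrightarrow> s \<le> t \<Longrightarrow> t \<le> c \<Longrightarrow>
        {s..t} \<inter> G = {} \<Longrightarrow> \<bar>x s - x t\<bar> \<le> e"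
      unfolding P_def by metis
    show "P a c"
      unfolding P_def
    proof (intro exI[of _ "insert b (F \<union> G)"] conjI allI impI)
      fix s t assume st: "s \<in> {0..1}" "t \<in> {0..1}" "a \<le> s" "s \<le> t" "t \<le> c"
        and disj: "{s..t} \<inter> insert b (F \<union> G) = {}"
      then have "t \<le> b \<or> b \<le> s" "{s..t} \<inter> F = {}" "{s..t} \<inter> G = {}" by auto
      then show "\<bar>x s - x t\<bar> \<le> e" using F(2)[of s t] G(2)[of s t] st by blast
    qed (use F G in simp)
  next
    fix c :: real assume "0 \<le> c" "c \<le> 1"
    then have c: "c \<in> {0..1}" by simp
    have "0 < e / 2" using e by simp
    from cadlag_near[OF x c this] obtain d where d: "0 < d"
      and R: "\<And>t. t \<in> {0..1} \<Longrightarrow> c < t \<Longrightarrow> t < c + d \<Longrightarrow> \<bar>x t - x c\<bar> \<le> e / 2 \<and> \<bar>left_limit x t - x c\<bar> \<le> e / 2"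
      and L: "\<And>t. t \<in> {0..1} \<Longrightarrow> c - d < t \<Longrightarrow> t < c \<Longrightarrow>
       \<bar>x t - left_limit x c\<bar> \<le> e / 2 \<and> \<bar>left_limit x t - left_limit x c\<bar> \<le> e / 2"
      by blast
    have "P a b" if ab: "a \<le> c" "c \<le> b" "b - a < d" for a b
      unfolding P_def
    proof (intro exI[of _ "{c}"] conjI allI impI)
      fix s t assume st: "s \<in> {0..1}" "t \<in> {0..1}" "a \<le> s" "s \<le> t" "t \<le> b" "{s..t} \<inter> {c} = {}"
      then consider "t < c" | "c < s" by fastforce
      then show "\<bar>x s - x t\<bar> \<le> e"
      proof cases
        case 1
        then show ?thesis using L[of s] L[of t] st ab by linarith
      next
        case 2
        then show ?thesis using R[of s] R[of t] st ab by linarith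
      qed
    qed simp
    with d show "\<exists>d>0. \<forall>a b. a \<le> c \<and> c \<le> b \<and> b - a < d \<longrightarrow> P a b" by blast
  qed simp
  then obtain F where F: "finite F" "\<And>s t. s \<in> {0..1} \<Longrightarrow> t \<in> {0..1} \<Longrightarrow> 0 \<le> s \<Longrightarrow> s \<le> t \<Longrightarrow> t \<le> 1 \<Longrightarrow>
        {s..t} \<inter> F = {} \<Longrightarrow> \<bar>x s - x t\<bar> \<le> e"
    unfolding P_def by metis
  show thesis by (rule that[OF F(1)]) (use F(2) in auto)
qed

text \<open>
  A jump larger than \<open>e\<close> cannot take place outside the finite set of exceptional times for \<open>e\<close>.
\<close>

lemma countable_jumps:
  assumes x: "cadlag x"
  shows "countable {t \<in> {0..1}. left_limit x t \<noteq> x t}"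
proof -
  have "\<exists>F. finite F \<and> (\<forall>s t. s \<in> {0..1} \<longrightarrow> t \<in> {0..1} \<longrightarrow> s \<le> t \<longrightarrow> {s..t} \<inter> F = {} \<longrightarrow>
     \<bar>x s - x t\<bar> \<le> inverse (real (Suc n)))" for n
    by (rule cadlag_finite_partition[OF x, of "inverse (real (Suc n))"]) auto
  then obtain F where F: "\<And>n. finite (F n)"
    "\<And>n s t. s \<in> {0..1} \<Longrightarrow> t \<in> {0..1} \<Longrightarrow> s \<le> t \<Longrightarrow> {s..t} \<inter> F n = {} \<Longrightarrow>
      \<bar>x s - x t\<bar> \<le> inverse (real (Suc n))"
    by metis
  have "{t \<in> {0..1}. left_limit x t \<noteq> x t} \<subseteq> (\<Union>n. F n)"
  proof safe
    fix t :: real assume t: "t \<in> {0..1}" and jump: "left_limit x t \<noteq> x t"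
    then have "0 < \<bar>left_limit x t - x t\<bar>" by simp
    from reals_Archimedean[OF this] obtain n where n: "inverse (real (Suc n)) < \<bar>left_limit x t - x t\<bar>"
      by blast
    have "t \<in> F n"
    proof (rule ccontr)
      assume tF: "t \<notin> F n"
      from finite_set_avoid[OF F(1), of n t] obtain d where d: "0 < d"
        "\<And>a. a \<in> F n \<Longrightarrow> a \<noteq> t \<Longrightarrow> d \<le> dist t a"
        by blast
      have "\<bar>left_limit x t - x t\<bar> \<le> inverse (real (Suc n))"
      proof (rule left_limit_bound[OF x t, of "t - d"])
        fix s assume s: "s \<in> {0..1}" "t - d < s" "s \<le> t"
        have "{s..t} \<inter> F n = {}"
          using d(2) tF s by (force simp: dist_real_def)
        then show "\<bar>x s - x t\<bar> \<le> inverse (real (Suc n))" using F(2) s t by simp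
      qed (use d in simp)
      with n show False by simp
    qed
    then show "t \<in> (\<Union>n. F n)" by blast
  qed
  moreover have "countable (\<Union>n. F n)" using F(1) by (simp add: countable_finite)
  ultimately show ?thesis by (rule countable_subset)
qed

lemma exists_atomic_distribution:
  assumes "countable (J :: real set)"
  obtains M where "real_distribution M" "\<And>t. t \<in> J \<Longrightarrow> 0 < measure M {t}"
proof -
  \<comment> \<open>The point 0 is added only because an enumeration needs a nonempty set.\<close>
  define e where "e = from_nat_into (insert 0 J)"
  define M where "M = distr (measure_pmf (geometric_pmf (1/2))) borel e"
  show thesis
  proof (rule that[of M])
    show "real_distribution M"
      unfolding M_def real_distribution_def real_distribution_axioms_def
      by (auto intro!: measure_pmf.prob_space_distr)
    fix t assume "t \<in> J"
    then obtain n where n: "e n = t"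
      using from_nat_into_surj[of "insert 0 J" t] assms unfolding e_def by auto
    have "0 < pmf (geometric_pmf (1/2)) n" by simp
    also have "\<dots> = measure (measure_pmf (geometric_pmf (1/2))) {n}" by (simp add: measure_pmf_single)
    also have "\<dots> \<le> measure (measure_pmf (geometric_pmf (1/2))) (e -` {t})"
      using n by (intro measure_pmf.finite_measure_mono) auto
    also have "\<dots> = measure M {t}" by (simp add: M_def measure_distr)
    finally show "0 < measure M {t}" .
  qed
qed

section \<open>Existence of parametric representations\<close>

text \<open>
  The function \<open>h\<close> is strictly increasing and jumps wherever \<open>x\<close> does. Its inverse \<open>tau\<close> is
  constant on the gap \<open>{hm t..h t}\<close> left by a jump at \<open>t\<close>, and on this gap \<open>chi\<close> moves linearly from the left limit
  of \<open>x\<close> to its value. At a gap of \<open>h\<close> where \<open>x\<close> is continuous, \<open>chi\<close> is constant, so superfluous atoms do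
  no harm.
\<close>

lemma param_reps_nonempty:
  assumes x: "cadlag x"
  shows "param_reps x \<noteq> {}"
proof -
  obtain M where M: "real_distribution M"
    and atom: "\<And>t. t \<in> {t \<in> {0..1}. left_limit x t \<noteq> x t} \<Longrightarrow> 0 < measure M {t}"
    using exists_atomic_distribution[OF countable_jumps[OF x]] by blast
  interpret real_distribution M by (rule M)
  \<comment> \<open>The summand \<open>t\<close> makes \<open>h\<close> strictly increasing and its inverse 1-Lipschitz; \<open>hm\<close> is the left limit of \<open>h\<close>.\<close>
  define h where "h t = t + cdf M t" for t
  define hm where "hm t = t + measure M {..<t}" for t
  have h_split: "h t = hm t + measure M {t}" for t
  proof -
    have "measure M ({..<t} \<union> {t}) = measure M {..<t} + measure M {t}"
      by (intro finite_measure_Union) auto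
    moreover have "{..<t} \<union> {t} = {..t}" by auto
    ultimately show ?thesis by (simp add: h_def hm_def cdf_def)
  qed
  have hm_le_h: "hm t \<le> h t" for t using h_split[of t] by simp
  have jump: "hm t < h t" if "t \<in> {0..1}" "left_limit x t \<noteq> x t" for t
    using h_split[of t] atom[of t] that by simp
  have gap: "t - s \<le> hm t - h s" if "s < t" for s t
  proof -
    have "measure M {..s} \<le> measure M {..<t}" using that by (intro finite_measure_mono) auto
    then show ?thesis by (simp add: h_def hm_def cdf_def)
  qed
  have h_mono: "h s \<le> h t" if "s \<le> t" for s t
    using that gap[of s t] hm_le_h[of t] by (cases "s = t") auto
  have hm_mono: "hm s \<le> hm t" if "s \<le> t" for s t
    using that gap[of s t] hm_le_h[of s] by (cases "s = t") auto

  define D where "D = {hm 0..h 1}"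
  have inverse_ex: "\<exists>t. t \<in> {0..1} \<and> hm t \<le> r \<and> r \<le> h t" if r: "r \<in> D" for r
  proof -
    \<comment> \<open>The time is the first one at which \<open>h\<close> reaches \<open>r\<close>: right continuity gives \<open>r \<le> h T\<close>, the left limit \<open>hm T \<le> r\<close>.\<close>
    define S where "S = {s \<in> {0..1}. r \<le> h s}"
    define T where "T = Inf S"
    have S: "1 \<in> S" "bdd_below S" using r by (auto simp: S_def D_def intro: bdd_belowI[of _ 0])
    have T: "T \<le> s" if "s \<in> S" for s using that S by (auto simp: T_def intro: cInf_lower)
    have T0: "0 \<le> T" unfolding T_def using S(1) by (intro cInf_greatest) (auto simp: S_def)
    have T1: "T \<le> 1" using T S(1) by simp
    have "r \<le> h T"
    proof (rule ccontr)
      assume "\<not> r \<le> h T"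
      then have lt: "h T < r" and "T < 1" using T1 S(1) by (auto simp: S_def order_le_less)
      have "continuous (at_right T) h"
        unfolding h_def by (intro continuous_intros cdf_is_right_cont)
      then have "eventually (\<lambda>s. h s < r) (at_right T)"
        using lt by (auto simp: continuous_within intro: order_tendstoD)
      then obtain b where b: "T < b" "\<And>s. T < s \<Longrightarrow> s < b \<Longrightarrow> h s < r"
        by (auto simp: eventually_at_right_field)
      define s where "s = (T + b) / 2"
      have s: "T < s" "h s < r" using b by (auto simp: s_def)
      have "s \<le> T"
        unfolding T_def
      proof (rule cInf_greatest)
        fix v assume "v \<in> S"
        then have "h s < h v" using s by (auto simp: S_def)
        then show "s \<le> v" using h_mono[of v s] by linarith
      qed (use S in auto)
      with s show False by simp
    qed
    moreover have "hm T \<le> r"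
    proof (cases "T = 0")
      case True
      then show ?thesis using r by (simp add: D_def)
    next
      case False
      have "(h \<longlongrightarrow> hm T) (at_left T)"
        unfolding h_def hm_def by (intro tendsto_intros cdf_at_left)
      moreover have "eventually (\<lambda>s. h s \<le> r) (at_left T)"
        using eventually_at_left_real[of 0 T]
      proof (rule eventually_mono)
        fix s assume "s \<in> {0<..<T}"
        then have "s \<notin> S" "s \<in> {0..1}" using T[of s] T1 by auto
        then show "h s \<le> r" by (simp add: S_def)
      qed (use False T0 in auto)
      ultimately show ?thesis
        by (rule tendsto_upperbound) (simp add: trivial_limit_at_left_real)
    qed
    ultimately show ?thesis using T0 T1 by auto
  qed
  define tau where "tau r = (SOME t. t \<in> {0..1} \<and> hm t \<le> r \<and> r \<le> h t)" for r
  have tau: "tau r \<in> {0..1}" "hm (tau r) \<le> r" "r \<le> h (tau r)" if "r \<in> D" for r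
    using someI_ex[OF inverse_ex[OF that]] by (simp_all add: tau_def)
  have tau_unique: "tau r = t" if "t \<in> {0..1}" "hm t \<le> r" "r \<le> h t" for r t
  proof -
    have "hm 0 \<le> hm t" "h t \<le> h 1" using that by (auto intro: hm_mono h_mono)
    then have r: "r \<in> D" using that by (auto simp: D_def)
    show ?thesis
      using tau[OF r] that gap[of "tau r" t] gap[of t "tau r"] by linarith
  qed
  have tau_lip: "tau r \<le> tau r' \<and> tau r' - tau r \<le> r' - r" if "r \<in> D" "r' \<in> D" "r \<le> r'" for r r'
    using tau[OF that(1)] tau[OF that(2)] that(3) gap[of "tau r" "tau r'"] gap[of "tau r'" "tau r"]
    by linarith

  \<comment> \<open>Where \<open>h\<close> does not jump, the quotient is 0 by convention, and \<open>x\<close> does not jump either.\<close>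
  define w where "w r = (r - hm (tau r)) / (h (tau r) - hm (tau r))" for r
  define chi where "chi r = left_limit x (tau r) + w r * (x (tau r) - left_limit x (tau r))" for r
  have w: "w r \<in> {0..1}" if "r \<in> D" for r
  proof -
    have "0 \<le> w r" using tau[OF that] by (simp add: w_def)
    moreover have "w r \<le> 1"
      unfolding w_def using tau[OF that] by (intro divide_le_eq_1[THEN iffD2]) auto
    ultimately show ?thesis by simp
  qed
  have chi_convex: "chi r = (1 - w r) * left_limit x (tau r) + (1 - (1 - w r)) * x (tau r)" for r
    by (simp add: chi_def algebra_simps)
  have chi_bound: "\<bar>chi r - c\<bar> \<le> e"
    if r: "r \<in> D" and b: "\<bar>x (tau r) - c\<bar> \<le> e \<and> \<bar>left_limit x (tau r) - c\<bar> \<le> e" for r c e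
  proof -
    have "chi r \<in> {c - e..c + e}"
      unfolding chi_convex
      using convexD_alt[of "{c - e..c + e}" "x (tau r)" "left_limit x (tau r)" "1 - w r"] w[OF r] b
      by (auto simp: abs_le_iff algebra_simps)
    then show ?thesis by auto
  qed
  have chi_linear: "\<bar>chi r - chi r'\<bar> = \<bar>r - r'\<bar> * \<bar>(x t - left_limit x t) / (h t - hm t)\<bar>"
    if "tau r = t" "tau r' = t" for r r' t
  proof -
    have "chi r - chi r' = (r - r') * ((x t - left_limit x t) / (h t - hm t))"
      using that by (simp add: chi_def w_def algebra_simps diff_divide_distrib add_divide_distrib)
    then show ?thesis by (simp only: abs_mult)
  qed
  have small: "\<exists>d>0. \<forall>b. \<bar>b\<bar> < d \<longrightarrow> \<bar>b\<bar> * \<bar>k\<bar> < e" if "0 < e" for k e :: real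
  proof (intro exI[of _ "e / (\<bar>k\<bar> + 1)"] conjI allI impI)
    fix b :: real assume "\<bar>b\<bar> < e / (\<bar>k\<bar> + 1)"
    then have "\<bar>b\<bar> * (\<bar>k\<bar> + 1) < e" by (simp add: pos_less_divide_eq)
    moreover have "\<bar>b\<bar> * \<bar>k\<bar> \<le> \<bar>b\<bar> * (\<bar>k\<bar> + 1)" by (intro mult_left_mono) auto
    ultimately show "\<bar>b\<bar> * \<bar>k\<bar> < e" by linarith
  qed (use that in simp)
  have chi_h: "chi r = x (tau r)" if "r \<in> D" "r = h (tau r)" for r
    using jump[of "tau r"] tau[OF that(1)] that(2)
    by (cases "left_limit x (tau r) = x (tau r)") (auto simp: chi_def w_def)
  have chi_hm: "chi r = left_limit x (tau r)" if "r = hm (tau r)" for r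
    using that by (simp add: chi_def w_def)
  \<comment> \<open>On each side of \<open>r0\<close>, either the gap of \<open>r0\<close> goes on, and \<open>chi\<close> is linear there, or it ends at \<open>r0\<close>,
    and the one-sided limit of \<open>x\<close> controls \<open>chi\<close> on the neighbouring gaps.\<close>
  have chi_cont: "continuous_on D chi"
    unfolding continuous_on_iff
  proof (intro ballI allI impI)
    fix r0 e :: real assume r0: "r0 \<in> D" and e: "0 < e"
    define t0 where "t0 = tau r0"
    have t0: "t0 \<in> {0..1}" "hm t0 \<le> r0" "r0 \<le> h t0" using tau[OF r0] by (auto simp: t0_def)
    have "0 < e / 2" using e by simp
    from cadlag_near[OF x t0(1) this] obtain d where d: "0 < d"
      and R: "\<And>t. t \<in> {0..1} \<Longrightarrow> t0 < t \<Longrightarrow> t < t0 + d \<Longrightarrow>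
        \<bar>x t - x t0\<bar> \<le> e / 2 \<and> \<bar>left_limit x t - x t0\<bar> \<le> e / 2"
      and L: "\<And>t. t \<in> {0..1} \<Longrightarrow> t0 - d < t \<Longrightarrow> t < t0 \<Longrightarrow>
        \<bar>x t - left_limit x t0\<bar> \<le> e / 2 \<and> \<bar>left_limit x t - left_limit x t0\<bar> \<le> e / 2"
      by blast
    obtain d' where d': "0 < d'"
      "\<And>b. \<bar>b\<bar> < d' \<Longrightarrow> \<bar>b\<bar> * \<bar>(x t0 - left_limit x t0) / (h t0 - hm t0)\<bar> < e"
      using small[OF e] by blast
    have same: "\<bar>chi r - chi r0\<bar> < e" if "hm t0 \<le> r" "r \<le> h t0" "\<bar>r - r0\<bar> < d'" for r
      using chi_linear[OF tau_unique[OF t0(1) that(1,2)] t0_def[symmetric]] d'(2)[OF that(3)] by simp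
    have right: "\<exists>a>0. \<forall>r\<in>D. r0 \<le> r \<longrightarrow> r < r0 + a \<longrightarrow> \<bar>chi r - chi r0\<bar> < e"
    proof (cases "r0 < h t0")
      case True
      show ?thesis
      proof (intro exI[of _ "min d' (h t0 - r0)"] conjI ballI impI)
        fix r assume "r \<in> D" "r0 \<le> r" "r < r0 + min d' (h t0 - r0)"
        then show "\<bar>chi r - chi r0\<bar> < e" using t0 by (intro same) auto
      qed (use True d' in auto)
    next
      case False
      then have eq: "r0 = h t0" using t0 by simp
      show ?thesis
      proof (intro exI[of _ d] conjI ballI impI)
        fix r assume r: "r \<in> D" "r0 \<le> r" "r < r0 + d"
        show "\<bar>chi r - chi r0\<bar> < e"
        proof (cases "r = r0")
          case False
          have "t0 \<le> tau r" "tau r - t0 \<le> r - r0" using tau_lip[OF r0 r(1,2)] by (auto simp: t0_def)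
          moreover have "tau r \<noteq> t0" using tau(3)[OF r(1)] eq r(2) False by auto
          ultimately have "\<bar>chi r - x t0\<bar> \<le> e / 2"
            using r tau[OF r(1)] by (intro chi_bound[OF r(1)] R) auto
          moreover have "chi r0 = x t0"
            unfolding t0_def by (rule chi_h[OF r0]) (rule eq[unfolded t0_def])
          ultimately show ?thesis using e by linarith
        qed (use e in simp)
      qed (rule d)
    qed
    have left: "\<exists>a>0. \<forall>r\<in>D. r \<le> r0 \<longrightarrow> r0 - a < r \<longrightarrow> \<bar>chi r - chi r0\<bar> < e"
    proof (cases "hm t0 < r0")
      case True
      show ?thesis
      proof (intro exI[of _ "min d' (r0 - hm t0)"] conjI ballI impI)
        fix r assume "r \<in> D" "r \<le> r0" "r0 - min d' (r0 - hm t0) < r"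
        then show "\<bar>chi r - chi r0\<bar> < e" using t0 by (intro same) auto
      qed (use True d' in auto)
    next
      case False
      then have eq: "r0 = hm t0" using t0 by simp
      show ?thesis
      proof (intro exI[of _ d] conjI ballI impI)
        fix r assume r: "r \<in> D" "r \<le> r0" "r0 - d < r"
        show "\<bar>chi r - chi r0\<bar> < e"
        proof (cases "r = r0")
          case False
          have "tau r \<le> t0" "t0 - tau r \<le> r0 - r" using tau_lip[OF r(1) r0 r(2)] by (auto simp: t0_def)
          moreover have "tau r \<noteq> t0" using tau(2)[OF r(1)] eq r(2) False by auto
          ultimately have "\<bar>chi r - left_limit x t0\<bar> \<le> e / 2"
            using r tau[OF r(1)] by (intro chi_bound[OF r(1)] L) auto
          moreover have "chi r0 = left_limit x t0"
            unfolding t0_def by (rule chi_hm) (rule eq[unfolded t0_def])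
          ultimately show ?thesis using e by linarith
        qed (use e in simp)
      qed (rule d)
    qed
    from right left obtain a b where ab: "0 < a" "0 < b"
      "\<And>r. r \<in> D \<Longrightarrow> r0 \<le> r \<Longrightarrow> r < r0 + a \<Longrightarrow> \<bar>chi r - chi r0\<bar> < e"
      "\<And>r. r \<in> D \<Longrightarrow> r \<le> r0 \<Longrightarrow> r0 - b < r \<Longrightarrow> \<bar>chi r - chi r0\<bar> < e"
      by blast
    show "\<exists>d>0. \<forall>r\<in>D. dist r r0 < d \<longrightarrow> dist (chi r) (chi r0) < e"
    proof (intro exI[of _ "min a b"] conjI ballI impI)
      fix r assume "r \<in> D" "dist r r0 < min a b"
      then show "dist (chi r) (chi r0) < e"
        using ab(3)[of r] ab(4)[of r] unfolding dist_real_def by linarith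
    qed (use ab in simp)
  qed
  have tau_cont: "continuous_on D tau"
    unfolding continuous_on_iff
  proof (intro ballI allI impI)
    fix r0 e :: real assume r0: "r0 \<in> D" and e: "0 < e"
    show "\<exists>d>0. \<forall>r\<in>D. dist r r0 < d \<longrightarrow> dist (tau r) (tau r0) < e"
    proof (intro exI[of _ e] conjI ballI impI)
      fix r assume r: "r \<in> D" "dist r r0 < e"
      then show "dist (tau r) (tau r0) < e"
        using tau_lip[OF r0 r(1)] tau_lip[OF r(1) r0] unfolding dist_real_def by linarith
    qed (rule e)
  qed
  have image: "(\<lambda>r. (chi r, tau r)) ` D = completed_graph x"
  proof
    show "(\<lambda>r. (chi r, tau r)) ` D \<subseteq> completed_graph x"
    proof (rule image_subsetI)
      fix r assume "r \<in> D"
      then show "(chi r, tau r) \<in> completed_graph x"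
        using w[of r] tau(1)[of r] chi_convex[of r] unfolding completed_graph_def
        by (intro CollectI exI[of _ "tau r"] exI[of _ "1 - w r"]) auto
    qed
    show "completed_graph x \<subseteq> (\<lambda>r. (chi r, tau r)) ` D"
    proof
      fix p assume "p \<in> completed_graph x"
      then obtain t l where p: "p = (l * left_limit x t + (1 - l) * x t, t)" "t \<in> {0..1}" "l \<in> {0..1}"
        by (auto simp: completed_graph_def)
      define r where "r = hm t + (1 - l) * (h t - hm t)"
      have "(1 - l) * (h t - hm t) \<le> 1 * (h t - hm t)"
        using p(3) hm_le_h[of t] by (intro mult_right_mono) auto
      then have r: "hm t \<le> r" "r \<le> h t" using p(3) hm_le_h[of t] by (auto simp: r_def)
      have tr: "tau r = t" by (rule tau_unique[OF p(2) r])
      have "hm 0 \<le> hm t" "h t \<le> h 1" using p(2) by (auto intro: hm_mono h_mono)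
      then have "r \<in> D" using r by (auto simp: D_def)
      moreover have "chi r = l * left_limit x t + (1 - l) * x t"
      proof (cases "left_limit x t = x t")
        case True
        then show ?thesis using tr by (simp add: chi_def algebra_simps)
      next
        case False
        then have "w r = 1 - l" using jump[OF p(2)] tr by (simp add: w_def r_def)
        then show ?thesis using tr chi_convex[of r] by simp
      qed
      ultimately show "p \<in> (\<lambda>r. (chi r, tau r)) ` D"
        using tr p(1) by (intro rev_image_eqI[of r]) auto
    qed
  qed
  have mono: "graph_le x (chi r, tau r) (chi r', tau r')" if "r \<in> D" "r' \<in> D" "r \<le> r'" for r r'
  proof (cases "tau r = tau r'")
    case True
    have "w r \<le> w r'"
      unfolding w_def True using that(3) hm_le_h[of "tau r'"] by (intro divide_right_mono) auto
    then have "\<bar>w r\<bar> * \<bar>x (tau r') - left_limit x (tau r')\<bar> \<le> \<bar>w r'\<bar> * \<bar>x (tau r') - left_limit x (tau r')\<bar>"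
      using w[OF that(1)] by (intro mult_right_mono) auto
    then show ?thesis using True by (simp add: graph_le_def chi_def abs_mult)
  next
    case False
    then show ?thesis using tau_lip[OF that] by (simp add: graph_le_def)
  qed

  define rho where "rho s = hm 0 + s * (h 1 - hm 0)" for s
  have len: "hm 0 < h 1" using gap[of 0 1] hm_le_h[of 0] hm_le_h[of 1] by simp
  have rho: "rho ` {0..1} = D"
  proof -
    have "rho ` {0..1} = (\<lambda>s. (h 1 - hm 0) * s + hm 0) ` {0..1}"
      by (simp add: rho_def algebra_simps)
    also have "\<dots> = D" using len unfolding D_def by (subst image_affinity_atLeastAtMost) auto
    finally show ?thesis .
  qed
  have "(\<lambda>s. chi (rho s), \<lambda>s. tau (rho s)) \<in> param_reps x"
    unfolding param_reps_def mem_Collect_eq prod.case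
  proof (intro conjI ballI impI)
    have "continuous_on {0..1} rho" unfolding rho_def by (intro continuous_intros)
    then show "continuous_on {0..1} (\<lambda>s. (chi (rho s), tau (rho s)))"
      using rho by (intro continuous_on_Pair continuous_on_compose2[OF chi_cont]
          continuous_on_compose2[OF tau_cont]) auto
    have "(\<lambda>s. (chi (rho s), tau (rho s))) ` {0..1} = (\<lambda>r. (chi r, tau r)) ` rho ` {0..1}"
      by (simp add: image_image)
    then show "(\<lambda>s. (chi (rho s), tau (rho s))) ` {0..1} = completed_graph x"
      by (simp only: rho image)
    fix s t :: real assume st: "s \<in> {0..1}" "t \<in> {0..1}" "s \<le> t"
    then have "rho s \<in> D" "rho t \<in> D" using rho by auto
    moreover have "rho s \<le> rho t" unfolding rho_def using st len by (simp add: mult_right_mono)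
    ultimately show "graph_le x (chi (rho s), tau (rho s)) (chi (rho t), tau (rho t))"
      by (rule mono)
  qed
  then show ?thesis by blast
qed

section \<open>Comparison of two coded trees\<close>

lemma coupling_prob_space:
  assumes M: "prob_space M" and nu: "\<nu> \<in> couplings M N"
  shows "prob_space \<nu>"
proof -
  have s: "sets \<nu> = sets (M \<Otimes>\<^sub>M N)" and d: "distr \<nu> M fst = M"
    using nu by (auto simp: couplings_def)
  have "fst \<in> measurable \<nu> M"
    using measurable_fst[of M N] by (simp add: measurable_cong_sets[OF s refl])
  then show ?thesis
    by (rule prob_space_distrD) (simp add: d M)
qed

lemma d_GHP_le:
  assumes K: "K \<in> mrc_spaces" and C: "C \<in> correspondences K L" "(mroot K, mroot L) \<in> C"
    and nu: "\<nu> \<in> couplings (mmeas K) (mmeas L)"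
  shows "d_GHP K L \<le> max (distortion K L C / 2) (1 - measure \<nu> C)"
  unfolding d_GHP_def
proof (rule cInf_lower)
  have pK: "prob_space (mmeas K)" using K by (simp add: mrc_spaces_def)
  show "bdd_below {max (distortion K L C / 2) (1 - measure \<nu> C) | C \<nu>.
     C \<in> correspondences K L \<and> (mroot K, mroot L) \<in> C \<and> \<nu> \<in> couplings (mmeas K) (mmeas L)}"
    by (rule bdd_belowI[of _ 0])
      (auto simp: le_max_iff_disj intro!: prob_space.prob_le_1 coupling_prob_space[OF pK])
qed (use C nu in blast)

text \<open>
  The correspondence consists of the pairs \<open>(p s, q t)\<close> with \<open>s\<close> and \<open>t\<close> close for the first
  pseudo-distance, made measurable by a discretisation: \<open>[0,1]\<close> is covered by finitely many compact
  pieces of small diameter, and \<open>C\<close> is a finite union of products of images of pieces. Only the distortion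
  bound has to be uniform in the representations, not the number of pieces.
\<close>

lemma d_GHP_codes_le:
  fixes chi1 tau1 chi2 tau2 :: "real \<Rightarrow> real"
  assumes chi1: "continuous_on {0..1} chi1" and chi2: "continuous_on {0..1} chi2"
    and K: "K \<in> mrc_spaces" and L: "L \<in> mrc_spaces"
    and p: "codes chi1 tau1 p K" and q: "codes chi2 tau2 q L"
    and near: "\<And>s. s \<in> {0..1} \<Longrightarrow> \<bar>chi1 s - chi2 s\<bar> \<le> d"
    and e: "0 < e"
    and G: "G \<in> sets (restrict_space lborel {0..1})"
      "\<And>u. u \<in> G \<Longrightarrow> tree_pdist chi1 (right_inverse tau1 u) (right_inverse tau2 u) \<le> e"
  shows "d_GHP K L \<le> max (3 * e + 2 * d) (1 - measure (restrict_space lborel {0..1}) G)"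
proof -
  have metK: "Metric_space (points K) (mdist K)" and metL: "Metric_space (points L) (mdist L)"
    and sK: "sets (mmeas K) = sets (borel_metric (points K) (mdist K))"
    and sL: "sets (mmeas L) = sets (borel_metric (points L) (mdist L))"
    using K L by (auto simp: mrc_spaces_def)
  have pc: "p ` I \<in> sets (mmeas K)" and qc: "q ` I \<in> sets (mmeas L)" if "compact I" "I \<subseteq> {0..1}" for I
  proof -
    have I: "compactin (top_of_set {0..1}) I" using that by (simp add: compactin_subtopology)
    show "p ` I \<in> sets (mmeas K)"
      using image_compactin[OF I codes_continuous_map[OF chi1 K p]]
        compactin_imp_closedin[OF Metric_space.Hausdorff_space_mtopology[OF metK]]
        closedin_sets_borel_metric[OF metK] sK
      by blast
    show "q ` I \<in> sets (mmeas L)"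
      using image_compactin[OF I codes_continuous_map[OF chi2 L q]]
        compactin_imp_closedin[OF Metric_space.Hausdorff_space_mtopology[OF metL]]
        closedin_sets_borel_metric[OF metL] sL
      by blast
  qed
  have pim: "p ` {0..1} = points K" and qim: "q ` {0..1} = points L"
    and proot: "p 0 = mroot K" and qroot: "q 0 = mroot L"
    using p q by (auto simp: codes_def)
  have dp: "mdist K (p s) (p t) = tree_pdist chi1 s t" and dq: "mdist L (q s) (q t) = tree_pdist chi2 s t"
    if "s \<in> {0..1}" "t \<in> {0..1}" for s t
    using that p q by (auto simp: codes_def)

  obtain r where r: "0 < r"
    "\<And>s t. s \<in> {0..1} \<Longrightarrow> t \<in> {0..1} \<Longrightarrow> \<bar>s - t\<bar> < r \<Longrightarrow> tree_pdist chi1 s t < e"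
    using tree_pdist_uniformly_small[OF chi1 e] by blast
  have "\<exists>k. finite k \<and> k \<subseteq> {0..1} \<and> {0..1::real} \<subseteq> (\<Union>c\<in>k. ball c (r / 3))"
    using r(1) compact_imp_seq_compact[of "{0..1::real}"]
    by (intro seq_compact_imp_totally_bounded[rule_format]) auto
  then obtain k where k: "finite k" "{0..1::real} \<subseteq> (\<Union>c\<in>k. ball c (r / 3))" by blast
  define I where "I c = {0..1} \<inter> cball c (r / 3)" for c :: real
  have I: "compact (I c)" "I c \<subseteq> {0..1}" for c by (auto simp: I_def intro: compact_Int)
  have cover: "\<exists>c\<in>k. s \<in> I c" if "s \<in> {0..1}" for s
    using that k(2) by (force simp: I_def)
  have mesh: "tree_pdist chi1 s t < e" if "s \<in> I c" "t \<in> I c" for s t c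
  proof (rule r(2))
    have "\<bar>c - s\<bar> \<le> r / 3" "\<bar>c - t\<bar> \<le> r / 3" using that by (auto simp: I_def dist_real_def)
    then show "\<bar>s - t\<bar> < r" using r(1) by linarith
  qed (use that in \<open>auto simp: I_def\<close>)

  \<comment> \<open>Passing to whole pieces costs at most \<open>e\<close> on either side, hence the \<open>3 * e\<close> below.\<close>
  define J where "J = {(c, c') \<in> k \<times> k. \<exists>s\<in>I c. \<exists>t\<in>I c'. tree_pdist chi1 s t \<le> e}"
  define C where "C = (\<Union>(c, c')\<in>J. p ` I c \<times> q ` I c')"
  have CI: "(p s, q t) \<in> C" if st: "s \<in> {0..1}" "t \<in> {0..1}" "tree_pdist chi1 s t \<le> e" for s t
  proof -
    obtain c c' where "c \<in> k" "s \<in> I c" "c' \<in> k" "t \<in> I c'"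
      using cover[OF st(1)] cover[OF st(2)] by blast
    then have "(c, c') \<in> J" "(p s, q t) \<in> p ` I c \<times> q ` I c'" using st by (auto simp: J_def)
    then show ?thesis unfolding C_def by blast
  qed
  have CE: "\<exists>s\<in>{0..1}. \<exists>t\<in>{0..1}. a = p s \<and> b = q t \<and> tree_pdist chi1 s t \<le> 3 * e"
    if ab: "(a, b) \<in> C" for a b
  proof -
    obtain c c' s t where ct: "(c, c') \<in> J" "s \<in> I c" "t \<in> I c'" "a = p s" "b = q t"
      using ab unfolding C_def by blast
    then obtain s0 t0 where st0: "s0 \<in> I c" "t0 \<in> I c'" "tree_pdist chi1 s0 t0 \<le> e"
      by (auto simp: J_def)
    have "s \<in> {0..1}" "t \<in> {0..1}" "s0 \<in> {0..1}" "t0 \<in> {0..1}" using ct st0 I(2) by blast+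
    then have "tree_pdist chi1 s t \<le> tree_pdist chi1 s s0 + (tree_pdist chi1 s0 t0 + tree_pdist chi1 t0 t)"
      using tree_pdist_triangle[OF chi1, of s s0 t] tree_pdist_triangle[OF chi1, of s0 t0 t] by linarith
    then have "tree_pdist chi1 s t \<le> 3 * e"
      using mesh[OF ct(2) st0(1)] mesh[OF st0(2) ct(3)] st0(3) by linarith
    with \<open>s \<in> {0..1}\<close> \<open>t \<in> {0..1}\<close> ct show ?thesis by blast
  qed
  have diag: "(p s, q s) \<in> C" if "s \<in> {0..1}" for s
    using that e by (intro CI) (auto simp: tree_pdist_refl)
  have Csets: "C \<in> sets (mmeas K \<Otimes>\<^sub>M mmeas L)"
  proof -
    have "J \<subseteq> k \<times> k" by (auto simp: J_def)
    then have "finite J" using k(1) by (meson finite_SigmaI finite_subset)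
    then show ?thesis
      unfolding C_def by (intro sets.finite_UN) (auto intro!: pair_measureI pc qc I)
  qed
  have Csub: "C \<subseteq> points K \<times> points L"
  proof
    fix z assume "z \<in> C"
    then obtain s t where "s \<in> {0..1}" "t \<in> {0..1}" "z = (p s, q t)"
      using CE[of "fst z" "snd z"] by (metis prod.collapse)
    then show "z \<in> points K \<times> points L" using pim qim by blast
  qed
  have Ccorr: "C \<in> correspondences K L"
    unfolding correspondences_def
  proof (intro CollectI conjI Csets Csub)
    show "fst ` C = points K"
    proof
      show "points K \<subseteq> fst ` C" unfolding pim[symmetric] using diag by force
    qed (use Csub in auto)
    show "snd ` C = points L"
    proof
      show "points L \<subseteq> snd ` C" unfolding qim[symmetric] using diag by force
    qed (use Csub in auto)
  qed
  have Croot: "(mroot K, mroot L) \<in> C" using diag[of 0] proot qroot by simp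
  have dist: "distortion K L C \<le> 6 * e + 4 * d"
    unfolding distortion_def
  proof (rule cSup_least)
    fix z assume "z \<in> {\<bar>mdist K y1 z1 - mdist L y2 z2\<bar> | y1 y2 z1 z2. (y1, y2) \<in> C \<and> (z1, z2) \<in> C}"
    then obtain a b a' b' where z: "z = \<bar>mdist K a a' - mdist L b b'\<bar>" "(a, b) \<in> C" "(a', b') \<in> C"
      by blast
    obtain s t where st: "s \<in> {0..1}" "t \<in> {0..1}" "a = p s" "b = q t" "tree_pdist chi1 s t \<le> 3 * e"
      using CE[OF z(2)] by blast
    obtain s' t' where st': "s' \<in> {0..1}" "t' \<in> {0..1}" "a' = p s'" "b' = q t'" "tree_pdist chi1 s' t' \<le> 3 * e"
      using CE[OF z(3)] by blast
    have "\<bar>tree_pdist chi1 s s' - tree_pdist chi1 t t'\<bar> \<le> tree_pdist chi1 s t + tree_pdist chi1 s' t'"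
      using tree_pdist_triangle[OF chi1 st(1) st(2) st'(1)] tree_pdist_triangle[OF chi1 st(2) st'(2) st'(1)]
        tree_pdist_triangle[OF chi1 st(2) st(1) st'(2)] tree_pdist_triangle[OF chi1 st(1) st'(1) st'(2)]
        tree_pdist_commute[of chi1 t s] tree_pdist_commute[of chi1 t' s']
      by linarith
    moreover have "\<bar>tree_pdist chi1 t t' - tree_pdist chi2 t t'\<bar> \<le> 4 * d"
      using near by (intro tree_pdist_perturb[OF chi1 chi2 st(2) st'(2)])
    ultimately show "z \<le> 6 * e + 4 * d"
      using st(5) st'(5) unfolding z(1) st(3,4) st'(3,4) dp[OF st(1) st'(1)] dq[OF st(2) st'(2)]
      by linarith
  qed (use Croot in blast)

  define \<nu> where "\<nu> = distr (restrict_space lborel {0..1}) (mmeas K \<Otimes>\<^sub>M mmeas L)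
    (\<lambda>u. (p (right_inverse tau1 u), q (right_inverse tau2 u)))"
  have mp: "(\<lambda>u. p (right_inverse tau1 u)) \<in> measurable (restrict_space lborel {0..1}) (mmeas K)"
    by (rule codes_measurable[OF chi1 K p])
  have mq: "(\<lambda>u. q (right_inverse tau2 u)) \<in> measurable (restrict_space lborel {0..1}) (mmeas L)"
    by (rule codes_measurable[OF chi2 L q])
  have mpq: "(\<lambda>u. (p (right_inverse tau1 u), q (right_inverse tau2 u)))
      \<in> measurable (restrict_space lborel {0..1}) (mmeas K \<Otimes>\<^sub>M mmeas L)"
    using mp mq by (rule measurable_Pair)
  have coupling: "\<nu> \<in> couplings (mmeas K) (mmeas L)"
    unfolding couplings_def
  proof (intro CollectI conjI)
    show "sets \<nu> = sets (mmeas K \<Otimes>\<^sub>M mmeas L)" by (simp add: \<nu>_def)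
    show "distr \<nu> (mmeas K) fst = mmeas K"
      unfolding \<nu>_def distr_distr[OF measurable_fst mpq] using p by (simp add: o_def codes_def)
    show "distr \<nu> (mmeas L) snd = mmeas L"
      unfolding \<nu>_def distr_distr[OF measurable_snd mpq] using q by (simp add: o_def codes_def)
  qed
  interpret unit: prob_space "restrict_space lborel {0..1::real}" by (rule prob_space_unit_lborel)
  have GC: "G \<subseteq> (\<lambda>u. (p (right_inverse tau1 u), q (right_inverse tau2 u))) -` C \<inter> {0..1}"
  proof
    fix u assume u: "u \<in> G"
    then have "u \<in> {0..1}" using sets.sets_into_space[OF G(1)] unfolding space_unit_lborel by blast
    then show "u \<in> (\<lambda>u. (p (right_inverse tau1 u), q (right_inverse tau2 u))) -` C \<inter> {0..1}"
      using CI[OF right_inverse_unit right_inverse_unit G(2)[OF u]] by blast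
  qed
  have "measure (restrict_space lborel {0..1}) G \<le> measure \<nu> C"
    unfolding \<nu>_def measure_distr[OF mpq Csets] space_unit_lborel
    using GC measurable_sets[OF mpq Csets] by (intro unit.finite_measure_mono) simp_all
  then show ?thesis
    using d_GHP_le[OF K Ccorr Croot coupling] dist by linarith
qed

section \<open>Tree classes as isometry classes\<close>

lemma tree_class_codes:
  assumes K: "K \<in> tree_class x" and rep: "(chi, tau) \<in> param_reps x"
  shows "K \<in> mrc_spaces" "\<exists>p. codes chi tau p K"
proof -
  obtain chi' tau' where rep': "(chi', tau') \<in> param_reps x"
    and rel: "(coded_tree (chi', tau'), K) \<in> mr_isometry_rel"
    using K unfolding tree_class_def by fast
  note c = param_rep_continuous(1)[OF rep']
  from rel show Km: "K \<in> mrc_spaces" by (simp add: mr_isometry_rel_def)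
  obtain q where "codes chi' tau' q K"
    using codes_isometric_image[OF c coded_tree(1)[OF c] Km coded_tree(2)[OF c]] rel
    by (auto simp: mr_isometry_rel_def)
  then show "\<exists>p. codes chi tau p K" by (rule codes_param_rep[OF rep' rep Km])
qed

lemma tree_class_eq:
  assumes rep: "(chi, tau) \<in> param_reps x"
  shows "tree_class x = mr_isometry_rel `` {coded_tree (chi, tau)}"
proof
  note c = param_rep_continuous(1)[OF rep]
  show "tree_class x \<subseteq> mr_isometry_rel `` {coded_tree (chi, tau)}"
  proof
    fix K assume K: "K \<in> tree_class x"
    then obtain p where "codes chi tau p K" using tree_class_codes(2)[OF _ rep] by blast
    then have "mr_isometric (coded_tree (chi, tau)) K"
      by (rule codes_unique[OF c coded_tree(1)[OF c] tree_class_codes(1)[OF K rep] coded_tree(2)[OF c]])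
    then show "K \<in> mr_isometry_rel `` {coded_tree (chi, tau)}"
      using coded_tree(1)[OF c] tree_class_codes(1)[OF K rep] by (simp add: mr_isometry_rel_def)
  qed
  show "mr_isometry_rel `` {coded_tree (chi, tau)} \<subseteq> tree_class x"
    unfolding tree_class_def using rep by (intro Image_mono) auto
qed

lemma tree_class_nonempty:
  assumes rep: "(chi, tau) \<in> param_reps x"
  shows "tree_class x \<noteq> {}"
proof -
  note c = param_rep_continuous(1)[OF rep]
  have "mr_isometric (coded_tree (chi, tau)) (coded_tree (chi, tau))"
    by (rule codes_unique[OF c coded_tree(1)[OF c] coded_tree(1)[OF c] coded_tree(2)[OF c] coded_tree(2)[OF c]])
  then have "coded_tree (chi, tau) \<in> mr_isometry_rel `` {coded_tree (chi, tau)}"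
    using coded_tree(1)[OF c] by (simp add: mr_isometry_rel_def)
  then show ?thesis unfolding tree_class_eq[OF rep] by blast
qed

section \<open>Continuity for the M1 distance\<close>

lemma sup_dist_bound:
  assumes f: "continuous_on {0..1} f" and g: "continuous_on {0..1} g" and s: "s \<in> {0..1}"
  shows "\<bar>f s - g s\<bar> \<le> sup_dist f g"
  unfolding sup_dist_def
proof (rule cSUP_upper[OF s])
  have "compact ((\<lambda>s. \<bar>f s - g s\<bar>) ` {0..1})"
    by (intro compact_continuous_image continuous_intros f g) simp
  then show "bdd_above ((\<lambda>s. \<bar>f s - g s\<bar>) ` {0..1})"
    by (intro bounded_imp_bdd_above compact_imp_bounded)
qed

text \<open>
  The window around \<open>u\<close> has radius \<open>2 * d\<close> rather than \<open>d\<close>, since the left limit at a time up to \<open>d\<close> away from \<open>u\<close>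
  involves slightly earlier times.
\<close>

lemma completed_graph_near:
  assumes x: "cadlag x" and d: "0 < d" and u: "u \<in> {0..1}"
    and F: "\<And>s t. s \<in> {0..1} \<Longrightarrow> t \<in> {0..1} \<Longrightarrow> s \<le> t \<Longrightarrow> {s..t} \<inter> F = {} \<Longrightarrow> \<bar>x s - x t\<bar> \<le> e"
    and avoid: "{u - 2 * d..u + 2 * d} \<inter> F = {}"
    and z: "(z, t) \<in> completed_graph x" and t: "\<bar>t - u\<bar> \<le> d"
  shows "\<bar>z - x u\<bar> \<le> e"
proof -
  obtain l where l: "l \<in> {0..1}" "z = l * left_limit x t + (1 - l) * x t" and t01: "t \<in> {0..1}"
    using z by (auto simp: completed_graph_def)
  have close: "\<bar>x s - x u\<bar> \<le> e" if s: "s \<in> {0..1}" "\<bar>s - u\<bar> \<le> 2 * d" for s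
  proof -
    have "{min s u..max s u} \<subseteq> {u - 2 * d..u + 2 * d}" using s d by auto
    then have "{min s u..max s u} \<inter> F = {}" using avoid by blast
    then show ?thesis using F[of s u] F[of u s] s u by (cases "s \<le> u") (auto simp: abs_minus_commute)
  qed
  have right: "\<bar>x t - x u\<bar> \<le> e" using close[OF t01] t d by simp
  have left: "\<bar>left_limit x t - x u\<bar> \<le> e"
    using t d by (intro left_limit_bound[OF x t01, of "t - d"] close) auto
  have "z \<in> {x u - e..x u + e}"
    unfolding l(2)
    using convexD_alt[of "{x u - e..x u + e}" "x t" "left_limit x t" l] l(1) left right
    by (auto simp: abs_le_iff algebra_simps)
  then show ?thesis by auto
qed

text \<open>
  Both parameters have a \<open>tau1\<close>-time within \<open>d\<close> of \<open>u\<close>, for the second one because \<open>tau2\<close> takes the value \<open>u\<close> there and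
  is close to \<open>tau1\<close>. By monotonicity the same holds for all parameters in between, so \<open>chi1\<close> stays
  near \<open>x u\<close> on the way.
\<close>

lemma tree_pdist_right_inverses_le:
  assumes x: "cadlag x" and d: "0 < d" and u: "u \<in> {0..1}"
    and F: "\<And>s t. s \<in> {0..1} \<Longrightarrow> t \<in> {0..1} \<Longrightarrow> s \<le> t \<Longrightarrow> {s..t} \<inter> F = {} \<Longrightarrow> \<bar>x s - x t\<bar> \<le> e"
    and avoid: "{u - 2 * d..u + 2 * d} \<inter> F = {}"
    and rep1: "(chi1, tau1) \<in> param_reps x" and rep2: "(chi2, tau2) \<in> param_reps y"
    and near: "\<And>s. s \<in> {0..1} \<Longrightarrow> \<bar>tau1 s - tau2 s\<bar> \<le> d"
  shows "tree_pdist chi1 (right_inverse tau1 u) (right_inverse tau2 u) \<le> 4 * e"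
proof (rule tree_pdist_le_oscillation[where c = "x u"])
  define s1 where "s1 = right_inverse tau1 u"
  define s2 where "s2 = right_inverse tau2 u"
  have s: "s1 \<in> {0..1}" "s2 \<in> {0..1}" unfolding s1_def s2_def by (rule right_inverse_unit)+
  have t1: "tau1 s1 = u" unfolding s1_def by (rule param_rep_right_inverse(1)[OF rep1 u])
  have "tau2 s2 = u" unfolding s2_def by (rule param_rep_right_inverse(1)[OF rep2 u])
  then have t2: "\<bar>tau1 s2 - u\<bar> \<le> d" using near[OF s(2)] by simp
  fix r assume r: "r \<in> {min (right_inverse tau1 u) (right_inverse tau2 u)..
      max (right_inverse tau1 u) (right_inverse tau2 u)}"
  then have r': "min s1 s2 \<le> r" "r \<le> max s1 s2" by (simp_all add: s1_def s2_def)
  then have r01: "r \<in> {0..1}" using s by auto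
  have "\<bar>tau1 r - u\<bar> \<le> d"
    using param_rep_tau_mono[OF rep1 r01 s(1)] param_rep_tau_mono[OF rep1 s(1) r01]
      param_rep_tau_mono[OF rep1 r01 s(2)] param_rep_tau_mono[OF rep1 s(2) r01] t1 t2 r' d
    by (auto simp: min_def max_def split: if_splits)
  with completed_graph_near[OF x d u F avoid param_rep_mem[OF rep1 r01]]
  show "\<bar>chi1 r - x u\<bar> \<le> e" by blast
qed

lemma measure_avoiding_times:
  assumes F: "finite F" and d: "0 < d"
  defines "G \<equiv> {0..1} - (\<Union>v\<in>F. {v - 2 * d..v + 2 * d :: real})"
  shows "G \<in> sets (restrict_space lborel {0..1})"
    and "1 - measure (restrict_space lborel {0..1}) G \<le> 4 * d * card F"
proof -
  interpret unit: prob_space "restrict_space lborel {0..1::real}" by (rule prob_space_unit_lborel)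
  define A where "A v = {0..1} \<inter> {v - 2 * d..v + 2 * d}" for v
  have A: "A v \<in> sets (restrict_space lborel {0..1})" for v
    by (auto simp: A_def sets_restrict_space)
  have U: "(\<Union>v\<in>F. A v) \<in> sets (restrict_space lborel {0..1})"
    using F A by (intro sets.finite_UN) auto
  have G: "G = space (restrict_space lborel {0..1}) - (\<Union>v\<in>F. A v)"
    by (auto simp: G_def A_def)
  then show "G \<in> sets (restrict_space lborel {0..1})" using sets.compl_sets[OF U] by simp
  have "measure (restrict_space lborel {0..1}) (A v) \<le> 4 * d" for v
  proof -
    have "measure (restrict_space lborel {0..1}) (A v) = measure lborel (A v)"
      by (rule measure_restrict_space) (auto simp: A_def)
    also have "\<dots> \<le> measure lborel {v - 2 * d..v + 2 * d}"
      by (rule measure_mono_fmeasurable) (auto simp: A_def fmeasurable_def emeasure_lborel_Icc_eq)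
    also have "\<dots> = 4 * d" using d by simp
    finally show ?thesis .
  qed
  then have "(\<Sum>v\<in>F. measure (restrict_space lborel {0..1}) (A v)) \<le> (\<Sum>v\<in>F. 4 * d)"
    by (intro sum_mono)
  moreover have "measure (restrict_space lborel {0..1}) (\<Union>v\<in>F. A v)
      \<le> (\<Sum>v\<in>F. measure (restrict_space lborel {0..1}) (A v))"
    using F A by (intro unit.finite_measure_subadditive_finite) auto
  ultimately show "1 - measure (restrict_space lborel {0..1}) G \<le> 4 * d * card F"
    using unit.prob_compl[OF U] unfolding G by (simp add: mult.commute)
qed

theorem proposition1p2:
  "tree_class \<in> D0_nonneg \<rightarrow> mrc_classes \<and>
   (\<forall>x\<in>D0_nonneg. \<forall>\<epsilon>>0. \<exists>\<delta>>0. \<forall>y\<in>D0_nonneg.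
      d_M1 x y < \<delta> \<longrightarrow> d_GHP_class (tree_class x) (tree_class y) < \<epsilon>)"
proof (intro conjI ballI allI impI funcsetI)
  fix x assume "x \<in> D0_nonneg"
  then obtain chi tau where rep: "(chi, tau) \<in> param_reps x"
    using param_reps_nonempty[of x] by (auto simp: D0_nonneg_def)
  show "tree_class x \<in> mrc_classes"
    unfolding tree_class_eq[OF rep] mrc_classes_def
    by (rule quotientI) (rule coded_tree(1)[OF param_rep_continuous(1)[OF rep]])
next
  fix x and \<epsilon> :: real assume "x \<in> D0_nonneg" and \<epsilon>: "0 < \<epsilon>"
  then have x: "cadlag x" by (simp add: D0_nonneg_def)
  obtain F where F: "finite F"
    "\<And>s t. s \<in> {0..1} \<Longrightarrow> t \<in> {0..1} \<Longrightarrow> s \<le> t \<Longrightarrow> {s..t} \<inter> F = {} \<Longrightarrow> \<bar>x s - x t\<bar> \<le> \<epsilon> / 48"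
    using cadlag_finite_partition[OF x, of "\<epsilon> / 48"] \<epsilon> by auto
  \<comment> \<open>With \<open>e = 4 * (\<epsilon> / 48)\<close> the distortion term is \<open>3 * e + 2 * \<delta> \<le> \<epsilon> / 2\<close>, and the missed mass is at most
    \<open>4 * \<delta> * card F \<le> \<epsilon> / 2\<close>; adding 1 to the cardinality covers the case of empty \<open>F\<close>.\<close>
  define \<delta> where "\<delta> = \<epsilon> / (8 * (card F + 1))"
  have \<delta>: "0 < \<delta>" using \<epsilon> by (simp add: \<delta>_def)
  have "\<delta> * (8 * (card F + 1)) = \<epsilon>" by (simp add: \<delta>_def)
  then have \<delta>_eq: "8 * (\<delta> * card F) + 8 * \<delta> = \<epsilon>" by (simp add: algebra_simps)
  have "d_GHP_class (tree_class x) (tree_class y) < \<epsilon>" if y: "y \<in> D0_nonneg" and close: "d_M1 x y < \<delta>" for y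
  proof -
    have "cadlag y" using y by (simp add: D0_nonneg_def)
    then obtain a where "a \<in> {max (sup_dist chi1 chi2) (sup_dist tau1 tau2) | chi1 tau1 chi2 tau2.
        (chi1, tau1) \<in> param_reps x \<and> (chi2, tau2) \<in> param_reps y}" "a < \<delta>"
      using close param_reps_nonempty[OF x] param_reps_nonempty[of y] unfolding d_M1_def
      by (elim cInf_lessD[THEN bexE, rotated]) auto
    then obtain chi1 tau1 chi2 tau2 where rep1: "(chi1, tau1) \<in> param_reps x"
      and rep2: "(chi2, tau2) \<in> param_reps y"
      and sd: "sup_dist chi1 chi2 < \<delta>" "sup_dist tau1 tau2 < \<delta>"
      by auto
    note c1 = param_rep_continuous[OF rep1] and c2 = param_rep_continuous[OF rep2]
    define K where "K = (SOME K. K \<in> tree_class x)"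
    define L where "L = (SOME L. L \<in> tree_class y)"
    have K: "K \<in> tree_class x" and L: "L \<in> tree_class y"
      unfolding K_def L_def using tree_class_nonempty[OF rep1] tree_class_nonempty[OF rep2]
      by (auto simp: some_in_eq)
    obtain p where p: "codes chi1 tau1 p K" using tree_class_codes(2)[OF K rep1] by blast
    obtain q where q: "codes chi2 tau2 q L" using tree_class_codes(2)[OF L rep2] by blast
    define G where "G = {0..1} - (\<Union>v\<in>F. {v - 2 * \<delta>..v + 2 * \<delta>})"
    have "d_GHP K L \<le> max (3 * (4 * (\<epsilon> / 48)) + 2 * \<delta>) (1 - measure (restrict_space lborel {0..1}) G)"
    proof (rule d_GHP_codes_le[OF c1(1) c2(1) tree_class_codes(1)[OF K rep1] tree_class_codes(1)[OF L rep2] p q])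
      show "\<bar>chi1 s - chi2 s\<bar> \<le> \<delta>" if "s \<in> {0..1}" for s
        using sup_dist_bound[OF c1(1) c2(1) that] sd(1) by simp
      show "G \<in> sets (restrict_space lborel {0..1})"
        unfolding G_def by (rule measure_avoiding_times(1)[OF F(1) \<delta>])
      fix u assume u: "u \<in> G"
      then have avoid: "{u - 2 * \<delta>..u + 2 * \<delta>} \<inter> F = {}" and "u \<in> {0..1}"
        by (force simp: G_def)+
      show "tree_pdist chi1 (right_inverse tau1 u) (right_inverse tau2 u) \<le> 4 * (\<epsilon> / 48)"
      proof (rule tree_pdist_right_inverses_le[OF x \<delta> \<open>u \<in> {0..1}\<close> F(2) avoid rep1 rep2])
        show "\<bar>tau1 s - tau2 s\<bar> \<le> \<delta>" if "s \<in> {0..1}" for s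
          using sup_dist_bound[OF c1(2) c2(2) that] sd(2) by simp
      qed
    qed (use \<epsilon> in simp)
    also have "\<dots> < \<epsilon>"
    proof -
      have "0 \<le> \<delta> * card F" using \<delta> by simp
      moreover have "1 - measure (restrict_space lborel {0..1}) G \<le> 4 * (\<delta> * card F)"
        unfolding G_def using measure_avoiding_times(2)[OF F(1) \<delta>] by (simp add: mult.assoc)
      ultimately show ?thesis unfolding max_less_iff_conj using \<delta>_eq \<delta> \<epsilon> by linarith
    qed
    finally show ?thesis by (simp add: d_GHP_class_def K_def L_def)
  qed
  with \<delta> show "\<exists>\<delta>>0. \<forall>y\<in>D0_nonneg.
      d_M1 x y < \<delta> \<longrightarrow> d_GHP_class (tree_class x) (tree_class y) < \<epsilon>"
    by blast
qed

end
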